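(* Let $E=E_{AR}$ be a fixed two-qubit unitary on $\mathbb{C}^2_A\otimes\mathbb{C}^2_R$, used as the only interaction between the ancilla qubit $A$ and any register qubit $R$ in ancilla-driven quantum computation (ADQC). Suppose there is an ADQC scheme $\mathcal S$ based on $E$ (as defined in the context) such that (i) the evolution of the register is unitary and step-wise deterministic; (ii) the interaction tensor-commutes with the corrections; (iii) the scheme admits universal state preparation of the register. Then $E$ is locally equivalent either to the Ising interaction with maximal coupling strength $\alpha=\pi/4$ or to the Heisenberg XX interaction with maximal coupling strength $\alpha_x=\alpha_y=\pi/4$. That is, there exist single-qubit unitaries $V',W'$ on the ancilla and $V,W$ on the register qubit such that, up to a global phase, $$E=(W'\otimes W)\,D\,(V'\otimes V),$$ where $$D=e^{-i\frac{\pi}{4}X\otimes X}\qquad\text{or}\qquad D=e^{-i\frac{\pi}{4}(X\otimes X+Y\otimes Y)} .$$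
   Context: Notation. $X,Y,Z$ are the Pauli matrices. Write $D(\alpha_x,\alpha_y,\alpha_z)=e^{-i(\alpha_x X\otimes X+\alpha_y Y\otimes Y+\alpha_z Z\otimes Z)}$. In a canonical decomposition $E_{AR}=(W'_A\otimes W_R)\,D_{AR}\,(V'_A\otimes V_R)$ with single-qubit unitaries $V',W',V,W$, the factor $D_{AR}$ is the non-local part of $E_{AR}$, and two interactions with the same non-local part are called locally equivalent. The Ising model corresponds to $D(\alpha,0,0)$ and the Heisenberg XX model to $D(\alpha_x,\alpha_y,0)$. Generalized Paulis. A generalized Pauli is a Hermitian $2\times2$ unitary $P$ with $\mathrm{tr}\,P=0$. Equivalently, $P=aX+bY+cZ$ with $a,b,c\in\mathbb{R}$ and $a^2+b^2+c^2=1$. ADQC. The register consists of $n\ge 1$ qubits, $n$ arbitrary. The register is never acted on directly. The only operations are elementary steps of the following two kinds. - Single-qubit step on register qubit $R$: prepare the ancilla in a pure state $|a\rangle_A$, apply $E_{AR}$, and measure the ancilla in an orthonormal basis $\{|b_+\rangle,|b_-\rangle\}$. This induces on the register the Kraus operators $K^\pm={}_A\langle b_\pm|E_{AR}|a\rangle_A$. - Two-qubit step on distinct register qubits $R,R'$: prepare the ancilla in $|a\rangle_A$, apply $E_{AR'}$ and then $E_{AR}$ (the same fixed $E$ on each ancilla-register pair), and measure the ancilla in an orthonormal basis $\{|b_+\rangle,|b_-\rangle\}$. This induces $K^\pm={}_A\langle b_\pm|E_{AR}E_{AR'}|a\rangle_A$. A scheme $\mathcal S$ based on $E$ is a choice of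 a set of allowed elementary steps: a set of triples $(|a\rangle,|b_+\rangle,|b_-\rangle)$ for single-qubit steps and a set of such triples for two-qubit steps. The allowed triples do not depend on $n$ or on which register qubits are addressed. (i) Unitary, step-wise deterministic. For every step in $\mathcal S$ one has $K^\pm=\sqrt{p^\pm}\,U^\pm$ with $p^\pm>0$ and $U^\pm$ unitary. Moreover, the two outcomes are related by a generalized Pauli correction. For a single-qubit step, $U^-=e^{i\Delta}P_R\,U^+$ with $\Delta\in\mathbb{R}$ and $P$ a generalized Pauli. For a two-qubit step, $U^-=e^{i\Delta}(P_R\otimes P'_{R'})\,U^+$, where each of $P,P'$ is a generalized Pauli or the identity. (ii) Tensor-commuting. A generalized Pauli $P$ on the register qubit tensor-commutes with the interaction if, when moved past the interaction, it remains a tensor product: $E_{AR}\,(\mathbb{1}_A\otimes P_R)\,E_{AR}^\dagger=\tilde P_A\otimes P'_R$, where each of $\tilde P,P'$ is a generalized Pauli or the identity (up to sign). Since generalized Paulis are preserved by unitary conjugation, this is equivalent to the same condition for the non-local part $D_{AR}$ applied to the correction as it arrives at $D_{AR}$, namely $VPV^\dagger$. The ancilla factor $\tilde P_A$ is absorbed by changing the ancilla measurement basis, and $P'_R$ is carried on to later steps. The interaction tensor-commutes with the corrections of $\mathcal S$ if every correction can be shifted through arbitrarily many later interactions in this way. That is, there is a set $\mathcal P$ of generalized Paulis containing all non-identity correction factors from (i) of steps in $\mathcal S$, such that every $P\in\mathcal P$ tensor-commutes with the interaction and the resulting register factor $P'$ is again in $\mathcal P$ or is the identity (up to sign). (iii)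 Universal state preparation. For every $n\ge1$, every unitary $U$ on the $n$-qubit register is, up to a global phase, a product of the unitaries $U^+$ of finitely many steps in $\mathcal S$ applied to suitable register qubits. For other measurement outcomes, the same $U$ is obtained up to the accumulated single-qubit corrections, which are removed by a final local redefinition of the computational basis. *)

theory Defs
  imports Complex_Main "Jordan_Normal_Form.Schur_Decomposition"
begin

section \<open>Matrices\<close>

definition unitary_op :: "nat \<Rightarrow> complex mat \<Rightarrow> bool" where
  "unitary_op d U \<longleftrightarrow>
     U \<in> carrier_mat d d \<and> U * mat_adjoint U = 1\<^sub>m d \<and> mat_adjoint U * U = 1\<^sub>m d"

definition mat_trace :: "complex mat \<Rightarrow> complex" where
  "mat_trace A = (\<Sum>i<dim_row A. A $$ (i, i))"

text \<open>Kronecker product; the first factor carries the most significant part of the index.\<close>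

definition kron :: "complex mat \<Rightarrow> complex mat \<Rightarrow> complex mat" (infixr \<open>\<otimes>\<^sub>k\<close> 75) where
  "A \<otimes>\<^sub>k B = mat (dim_row A * dim_row B) (dim_col A * dim_col B)
     (\<lambda>(i, j). A $$ (i div dim_row B, j div dim_col B) * B $$ (i mod dim_row B, j mod dim_col B))"

definition mat_exp :: "complex mat \<Rightarrow> complex mat" where
  "mat_exp A = mat (dim_row A) (dim_row A) (\<lambda>ij. \<Sum>k. (A ^\<^sub>m k) $$ ij / fact k)"

definition pauli_X :: "complex mat" where
  "pauli_X = mat_of_rows_list 2 [[0, 1], [1, 0]]"

definition pauli_Y :: "complex mat" where
  "pauli_Y = mat_of_rows_list 2 [[0, - \<i>], [\<i>, 0]]"

definition pauli_Z :: "complex mat" where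
  "pauli_Z = mat_of_rows_list 2 [[1, 0], [0, - 1]]"

definition nonlocal_D :: "real \<Rightarrow> real \<Rightarrow> real \<Rightarrow> complex mat" where
  "nonlocal_D \<alpha>x \<alpha>y \<alpha>z = mat_exp (- \<i> \<cdot>\<^sub>m
     (complex_of_real \<alpha>x \<cdot>\<^sub>m (pauli_X \<otimes>\<^sub>k pauli_X)
      + complex_of_real \<alpha>y \<cdot>\<^sub>m (pauli_Y \<otimes>\<^sub>k pauli_Y)
      + complex_of_real \<alpha>z \<cdot>\<^sub>m (pauli_Z \<otimes>\<^sub>k pauli_Z)))"

definition gen_pauli :: "complex mat \<Rightarrow> bool" where
  "gen_pauli P \<longleftrightarrow> unitary_op 2 P \<and> mat_adjoint P = P \<and> mat_trace P = 0"

definition gen_pauli_or_id :: "complex mat \<Rightarrow> bool" where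
  "gen_pauli_or_id P \<longleftrightarrow> gen_pauli P \<or> P = 1\<^sub>m 2"

definition gen_pauli_or_pm_id :: "complex mat \<Rightarrow> bool" where
  "gen_pauli_or_pm_id P \<longleftrightarrow> gen_pauli P \<or> P = 1\<^sub>m 2 \<or> P = - 1\<^sub>m 2"

section \<open>Ancilla and register\<close>

text \<open>
  Operators on an \<open>n\<close>-qubit register are \<open>2 ^ n \<times> 2 ^ n\<close> matrices, with qubit \<open>0\<close> the leftmost
  tensor factor.  The ancilla is placed to the left of the whole register.
\<close>

definition on_qubit :: "nat \<Rightarrow> nat \<Rightarrow> complex mat \<Rightarrow> complex mat" where
  "on_qubit n R P = 1\<^sub>m (2 ^ R) \<otimes>\<^sub>k P \<otimes>\<^sub>k 1\<^sub>m (2 ^ (n - 1 - R))"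

text \<open>
  \<open>E\<^sub>A\<^sub>R\<close> on ancilla and register: writing \<open>E = \<Sum>p q. |p\<rangle>\<langle>q| \<otimes> E\<^sub>p\<^sub>q\<close> with \<open>2 \<times> 2\<close> blocks \<open>E\<^sub>p\<^sub>q\<close>,
  each block acts on register qubit \<open>R\<close>.
\<close>

definition couple :: "nat \<Rightarrow> complex mat \<Rightarrow> nat \<Rightarrow> complex mat" where
  "couple n E R = (case split_block E 2 2 of (E00, E01, E10, E11) \<Rightarrow>
     four_block_mat (on_qubit n R E00) (on_qubit n R E01) (on_qubit n R E10) (on_qubit n R E11))"

definition ket :: "complex vec \<Rightarrow> complex mat" where
  "ket v = mat_of_cols (dim_vec v) [v]"

definition bra :: "complex vec \<Rightarrow> complex mat" where
  "bra v = mat_adjoint (ket v)"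

definition ancilla_element :: "nat \<Rightarrow> complex vec \<Rightarrow> complex mat \<Rightarrow> complex vec \<Rightarrow> complex mat" where
  "ancilla_element n b M a = (bra b \<otimes>\<^sub>k 1\<^sub>m (2 ^ n)) * M * (ket a \<otimes>\<^sub>k 1\<^sub>m (2 ^ n))"

section \<open>Schemes\<close>

datatype outcome = Plus | Minus

type_synonym basis = "complex vec \<times> complex vec"

type_synonym setting = "complex vec \<times> basis"

definition unit_state :: "complex vec \<Rightarrow> bool" where
  "unit_state a \<longleftrightarrow> a \<in> carrier_vec 2 \<and> a \<bullet>c a = 1"

definition orthonormal_basis :: "basis \<Rightarrow> bool" where
  "orthonormal_basis b \<longleftrightarrow> unit_state (fst b) \<and> unit_state (snd b) \<and> fst b \<bullet>c snd b = 0"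

fun basis_vec :: "basis \<Rightarrow> outcome \<Rightarrow> complex vec" where
  "basis_vec (bp, bm) Plus = bp"
| "basis_vec (bp, bm) Minus = bm"

record scheme =
  single_settings :: "setting set"
  double_settings :: "setting set"

definition valid_scheme :: "scheme \<Rightarrow> bool" where
  "valid_scheme S \<longleftrightarrow>
     (\<forall>(a, b) \<in> single_settings S \<union> double_settings S. unit_state a \<and> orthonormal_basis b)"

datatype step = Single setting nat | Double setting nat nat

fun setting_of :: "step \<Rightarrow> setting" where
  "setting_of (Single t R) = t"
| "setting_of (Double t R R') = t"

fun with_basis :: "basis \<Rightarrow> step \<Rightarrow> step" where
  "with_basis b (Single t R) = Single (fst t, b) R"
| "with_basis b (Double t R R') = Double (fst t, b) R R'"

definition steps :: "nat \<Rightarrow> scheme \<Rightarrow> step set" where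
  "steps n S = {Single t R | t R. t \<in> single_settings S \<and> R < n}
     \<union> {Double t R R' | t R R'. t \<in> double_settings S \<and> R < n \<and> R' < n \<and> R \<noteq> R'}"

fun interaction :: "nat \<Rightarrow> complex mat \<Rightarrow> step \<Rightarrow> complex mat" where
  "interaction n E (Single t R) = couple n E R"
| "interaction n E (Double t R R') = couple n E R * couple n E R'"

definition kraus :: "nat \<Rightarrow> complex mat \<Rightarrow> step \<Rightarrow> outcome \<Rightarrow> complex mat" where
  "kraus n E s \<omega> =
     ancilla_element n (basis_vec (snd (setting_of s)) \<omega>) (interaction n E s) (fst (setting_of s))"

definition induces_unitary ::
  "nat \<Rightarrow> complex mat \<Rightarrow> step \<Rightarrow> outcome \<Rightarrow> complex mat \<Rightarrow> bool" where
  "induces_unitary n E s \<omega> U \<longleftrightarrow>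
     unitary_op (2 ^ n) U \<and> (\<exists>p::real. p > 0 \<and> kraus n E s \<omega> = complex_of_real (sqrt p) \<cdot>\<^sub>m U)"

section \<open>Step-wise determinism\<close>

definition related_by :: "nat \<Rightarrow> complex mat \<Rightarrow> step \<Rightarrow> complex mat \<Rightarrow> bool" where
  "related_by n E s C \<longleftrightarrow> (\<exists>Up Um \<Delta>.
     induces_unitary n E s Plus Up \<and> induces_unitary n E s Minus Um \<and> Um = cis \<Delta> \<cdot>\<^sub>m (C * Up))"

definition single_correction ::
  "nat \<Rightarrow> complex mat \<Rightarrow> setting \<Rightarrow> nat \<Rightarrow> complex mat \<Rightarrow> bool" where
  "single_correction n E t R P \<longleftrightarrow> gen_pauli P \<and> related_by n E (Single t R) (on_qubit n R P)"

definition double_correction ::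
  "nat \<Rightarrow> complex mat \<Rightarrow> setting \<Rightarrow> nat \<Rightarrow> nat \<Rightarrow> complex mat \<Rightarrow> complex mat \<Rightarrow> bool" where
  "double_correction n E t R R' P P' \<longleftrightarrow> gen_pauli_or_id P \<and> gen_pauli_or_id P' \<and>
     related_by n E (Double t R R') (on_qubit n R P * on_qubit n R' P')"

definition stepwise_deterministic :: "complex mat \<Rightarrow> scheme \<Rightarrow> bool" where
  "stepwise_deterministic E S \<longleftrightarrow> (\<forall>n\<ge>1.
     (\<forall>t R. Single t R \<in> steps n S \<longrightarrow> (\<exists>P. single_correction n E t R P)) \<and>
     (\<forall>t R R'. Double t R R' \<in> steps n S \<longrightarrow> (\<exists>P P'. double_correction n E t R R' P P')))"

section \<open>Tensor-commuting corrections\<close>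

text \<open>
  A correction factor is determined by its step only up to sign, the sign being absorbed in the
  phase \<open>\<Delta>\<close>; the set below contains both signs.
\<close>

definition correction_factors :: "complex mat \<Rightarrow> scheme \<Rightarrow> complex mat set" where
  "correction_factors E S =
     {P. \<exists>n\<ge>1. \<exists>t R. Single t R \<in> steps n S \<and> single_correction n E t R P}
     \<union> {P. gen_pauli P \<and> (\<exists>n\<ge>1. \<exists>t R R' P'. Double t R R' \<in> steps n S \<and>
          (double_correction n E t R R' P P' \<or> double_correction n E t R R' P' P))}"

definition tensor_commutes_to :: "complex mat \<Rightarrow> complex mat \<Rightarrow> complex mat \<Rightarrow> bool" where
  "tensor_commutes_to E P P' \<longleftrightarrow> gen_pauli_or_pm_id P' \<and>
     (\<exists>Pa. gen_pauli_or_pm_id Pa \<and> E * (1\<^sub>m 2 \<otimes>\<^sub>k P) * mat_adjoint E = Pa \<otimes>\<^sub>k P')"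

definition tensor_commuting :: "complex mat \<Rightarrow> scheme \<Rightarrow> bool" where
  "tensor_commuting E S \<longleftrightarrow> (\<exists>\<P>. (\<forall>P \<in> \<P>. gen_pauli P) \<and> correction_factors E S \<subseteq> \<P> \<and>
     (\<forall>P \<in> \<P>. \<exists>P'. tensor_commutes_to E P P' \<and> (P' \<in> \<P> \<or> P' = 1\<^sub>m 2 \<or> P' = - 1\<^sub>m 2)))"

section \<open>Universality\<close>

text \<open>The head of a list of operators is applied first.\<close>

definition ordered_prod :: "nat \<Rightarrow> complex mat list \<Rightarrow> complex mat" where
  "ordered_prod n Us = foldl (\<lambda>V U. U * V) (1\<^sub>m (2 ^ n)) Us"

inductive_set local_corrections :: "nat \<Rightarrow> complex mat set" for n where
  no_correction: "1\<^sub>m (2 ^ n) \<in> local_corrections n"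
| add_correction:
    "L \<in> local_corrections n \<Longrightarrow> gen_pauli P \<Longrightarrow> R < n \<Longrightarrow> on_qubit n R P * L \<in> local_corrections n"

text \<open>
  Corrections are absorbed by changing later measurement bases: in an adaptive run, the basis
  \<open>\<beta> h\<close> used in the next step may depend on the outcomes \<open>h\<close> obtained so far.  The run realises
  the operator below when the outcomes are \<open>w\<close>.
\<close>

definition adaptive_run ::
  "nat \<Rightarrow> complex mat \<Rightarrow> step list \<Rightarrow> (outcome list \<Rightarrow> basis) \<Rightarrow> outcome list \<Rightarrow> complex mat" where
  "adaptive_run n E ss \<beta> w =
     ordered_prod n (map (\<lambda>k. kraus n E (with_basis (\<beta> (take k w)) (ss ! k)) (w ! k)) [0..<length ss])"

text \<open>
  The prescribed bases are used as long as all outcomes were \<open>Plus\<close>, and for every outcome string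
  the run realises \<open>U\<close> up to single-qubit corrections and a scalar (global phase and square root
  of the probability).
\<close>

definition corrected_for_all_outcomes ::
  "nat \<Rightarrow> complex mat \<Rightarrow> step list \<Rightarrow> complex mat \<Rightarrow> bool" where
  "corrected_for_all_outcomes n E ss U \<longleftrightarrow> (\<exists>\<beta>.
     (\<forall>h. orthonormal_basis (\<beta> h)) \<and>
     (\<forall>k < length ss. \<beta> (replicate k Plus) = snd (setting_of (ss ! k))) \<and>
     (\<forall>w. length w = length ss \<longrightarrow>
        (\<exists>c. \<exists>L \<in> local_corrections n. c \<noteq> 0 \<and> adaptive_run n E ss \<beta> w = c \<cdot>\<^sub>m (L * U))))"

definition universal :: "complex mat \<Rightarrow> scheme \<Rightarrow> bool" where
  "universal E S \<longleftrightarrow> (\<forall>n\<ge>1. \<forall>U. unitary_op (2 ^ n) U \<longrightarrow>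
     (\<exists>ss Us \<phi>. set ss \<subseteq> steps n S
        \<and> list_all2 (\<lambda>s V. induces_unitary n E s Plus V) ss Us
        \<and> U = cis \<phi> \<cdot>\<^sub>m ordered_prod n Us
        \<and> corrected_for_all_outcomes n E ss U))"

end

theory Submission
  imports Defs
begin

text \<open>
  Single-qubit registers suffice.  If a step has outcomes \<open>K\<^sup>+ = u U\<close> and \<open>K\<^sup>- = v P U\<close>, then
  \<open>E (1 \<otimes> Q) = (A \<otimes> B) E\<close> gives \<open>U Q = B (x + y P) U\<close> for some scalars \<open>x\<close>, \<open>y\<close>, because \<open>A\<close> only
  turns the first measurement vector into a combination of the two.  If all corrections agreed up to
  sign, taking \<open>Q = P\<close> and comparing traces would show that every \<open>U\<close> conjugates \<open>P\<close> to a multiple of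
  itself, against universality.  So there are two non-commuting corrections \<open>P\<close>, \<open>Q\<close>.

  Each of their images under conjugation by \<open>E\<close> has the form \<open>1 \<otimes> B\<close>, \<open>A \<otimes> 1\<close> or \<open>A \<otimes> B\<close>.  Two images
  \<open>1 \<otimes> B\<close> or two images \<open>A \<otimes> 1\<close> (\<open>E\<close> local, or locally a swap) contradict the identity above, used for
  both outcomes; one image of each of these forms would make \<open>P\<close> and \<open>Q\<close> commute.  If one image is
  \<open>1 \<otimes> B\<close> and the other \<open>A \<otimes> B'\<close>, comparing anticommutators shows that \<open>E\<close> conjugates the register
  algebra as the Ising interaction does, up to local unitaries; \<open>A \<otimes> 1\<close> and \<open>A' \<otimes> B\<close> give the XX
  interaction.  If both images are proper tensor products, a multiple of the commutator of \<open>P\<close> and \<open>Q\<close>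
  is a generalized Pauli with image \<open>1 \<otimes> B\<close> or \<open>A \<otimes> 1\<close>.  Two interactions that conjugate the register
  algebra in the same way differ by an ancilla unitary, so no canonical decomposition of \<open>E\<close> is needed.
\<close>

section \<open>Adjoints, Kronecker products and \<open>2 \<times> 2\<close> matrices\<close>

text \<open>Associativity is oriented either way below, so the global rewrite rule would loop.\<close>

declare assoc_mult_mat [simp del]

section \<open>Adjoints of complex matrices\<close>

lemma mat_adjoint_index [simp]:
  "i < dim_col A \<Longrightarrow> j < dim_row A \<Longrightarrow> mat_adjoint A $$ (i, j) = conjugate (A $$ (j, i))"
  by (simp add: mat_adjoint_def mat_of_rows_def)

lemma mat_adjoint_dim [simp]:
  "dim_row (mat_adjoint A) = dim_col A" "dim_col (mat_adjoint A) = dim_row A"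
  by (auto simp: mat_adjoint_def mat_of_rows_def)

lemma mat_adjoint_carrier [simp, intro]:
  "A \<in> carrier_mat m n \<Longrightarrow> mat_adjoint A \<in> carrier_mat n m"
  by auto

lemma mat_adjoint_mult:
  fixes A :: "complex mat"
  assumes "A \<in> carrier_mat m n" "B \<in> carrier_mat n k"
  shows "mat_adjoint (A * B) = mat_adjoint B * mat_adjoint A"
  by (rule eq_matI) (use assms in \<open>auto simp: scalar_prod_def mult.commute\<close>)

lemma mat_adjoint_mat_adjoint [simp]: "mat_adjoint (mat_adjoint A) = (A :: complex mat)"
  by (rule eq_matI) auto

lemma mat_adjoint_one [simp]: "mat_adjoint (1\<^sub>m n) = (1\<^sub>m n :: complex mat)"
  by (rule eq_matI) auto

section \<open>Kronecker products: index arithmetic, mixed products, bilinearity\<close>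

lemma kron_dim [simp]:
  "dim_row (A \<otimes>\<^sub>k B) = dim_row A * dim_row B" "dim_col (A \<otimes>\<^sub>k B) = dim_col A * dim_col B"
  by (simp_all add: kron_def)

lemma kron_index [simp]:
  "i < dim_row A * dim_row B \<Longrightarrow> j < dim_col A * dim_col B \<Longrightarrow>
   (A \<otimes>\<^sub>k B) $$ (i, j) =
     A $$ (i div dim_row B, j div dim_col B) * B $$ (i mod dim_row B, j mod dim_col B)"
  by (simp add: kron_def)

lemma div_mod_less:
  fixes i m n :: nat
  assumes "i < m * n"
  shows "i div n < m" "i mod n < n"
  using assms by (auto simp: less_mult_imp_div_less intro!: mod_less_divisor gr0I)

text \<open>Quotient and remainder modulo \<open>n\<close> identify the indices below
  \<open>m * n\<close> with pairs, so a sum of products separates. This performs the sum over the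
  contracted index in the mixed-product rule.\<close>

lemma sum_div_mod:
  fixes f g :: "nat \<Rightarrow> 'a :: comm_semiring_1"
  shows "(\<Sum>k<m * n. f (k div n) * g (k mod n)) = (\<Sum>i<m. f i) * (\<Sum>j<n. g j)"
proof -
  have "(\<Sum>k<m * n. f (k div n) * g (k mod n)) =
      (\<Sum>i<m. \<Sum>k\<in>{i * n..<i * n + n}. f (k div n) * g (k mod n))"
    by (rule sum.nat_group [symmetric])
  also have "\<dots> = (\<Sum>i<m. \<Sum>j<n. f i * g j)"
  proof (rule sum.cong)
    fix i
    have "(\<Sum>k\<in>{i * n..<i * n + n}. f (k div n) * g (k mod n)) =
        (\<Sum>j<n. f ((j + i * n) div n) * g ((j + i * n) mod n))"
      using sum.shift_bounds_nat_ivl [of "\<lambda>k. f (k div n) * g (k mod n)" 0 "i * n" n]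
      by (simp add: add.commute lessThan_atLeast0)
    also have "\<dots> = (\<Sum>j<n. f i * g j)"
      by (rule sum.cong) (auto simp: div_mult_self3)
    finally show "(\<Sum>k\<in>{i * n..<i * n + n}. f (k div n) * g (k mod n)) = (\<Sum>j<n. f i * g j)" .
  qed simp
  finally show ?thesis by (simp add: sum_product)
qed

text \<open>The inner summation index splits into quotient and remainder modulo \<open>n'\<close>,
  which separates the two factors. Rectangular shapes are allowed because bras and kets are tensored
  with identities later.\<close>

lemma kron_mult:
  assumes "A \<in> carrier_mat m n" "B \<in> carrier_mat m' n'"
    and "C \<in> carrier_mat n k" "D \<in> carrier_mat n' k'"
  shows "(A \<otimes>\<^sub>k B) * (C \<otimes>\<^sub>k D) = (A * C) \<otimes>\<^sub>k (B * D)"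
proof (rule eq_matI)
  fix i j
  assume "i < dim_row ((A * C) \<otimes>\<^sub>k (B * D))" "j < dim_col ((A * C) \<otimes>\<^sub>k (B * D))"
  then have ij: "i < m * m'" "j < k * k'" using assms by auto
  note dm = div_mod_less [OF ij(1)] div_mod_less [OF ij(2)]
  have "((A \<otimes>\<^sub>k B) * (C \<otimes>\<^sub>k D)) $$ (i, j) =
      (\<Sum>l<n * n'. (A $$ (i div m', l div n') * C $$ (l div n', j div k')) *
                  (B $$ (i mod m', l mod n') * D $$ (l mod n', j mod k')))"
    using ij assms by (simp add: scalar_prod_def lessThan_atLeast0 mult.assoc mult.left_commute)
  also have "\<dots> = ((A * C) \<otimes>\<^sub>k (B * D)) $$ (i, j)"
    using ij dm assms
    by (subst sum_div_mod [where f = "\<lambda>l. A $$ (i div m', l) * C $$ (l, j div k')"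
          and g = "\<lambda>l. B $$ (i mod m', l) * D $$ (l, j mod k')"])
       (simp add: scalar_prod_def lessThan_atLeast0)
  finally show "((A \<otimes>\<^sub>k B) * (C \<otimes>\<^sub>k D)) $$ (i, j) = ((A * C) \<otimes>\<^sub>k (B * D)) $$ (i, j)" .
qed (use assms in auto)

lemma kron_carrier [simp, intro]:
  "A \<in> carrier_mat m n \<Longrightarrow> B \<in> carrier_mat m' n' \<Longrightarrow> A \<otimes>\<^sub>k B \<in> carrier_mat (m * m') (n * n')"
  by auto

lemma kron_carrier_4 [simp, intro]:
  "A \<in> carrier_mat 2 2 \<Longrightarrow> B \<in> carrier_mat 2 2 \<Longrightarrow> A \<otimes>\<^sub>k B \<in> carrier_mat 4 4"
  by auto

lemma kron_one_one: "1\<^sub>m m \<otimes>\<^sub>k 1\<^sub>m n = 1\<^sub>m (m * n)"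
proof (rule eq_matI)
  fix i j assume "i < dim_row (1\<^sub>m (m * n))" "j < dim_col (1\<^sub>m (m * n))"
  then have ij: "i < m * n" "j < m * n" by auto
  have "i div n = j div n \<and> i mod n = j mod n \<longleftrightarrow> i = j"
    by (metis div_mult_mod_eq)
  then show "(1\<^sub>m m \<otimes>\<^sub>k 1\<^sub>m n) $$ (i, j) = 1\<^sub>m (m * n) $$ (i, j)"
    using ij div_mod_less [OF ij(1)] div_mod_less [OF ij(2)] by auto
qed auto

lemma kron_one_left [simp]: "1\<^sub>m (Suc 0) \<otimes>\<^sub>k A = A"
  by (rule eq_matI) auto

lemma kron_one_right [simp]: "A \<otimes>\<^sub>k 1\<^sub>m (Suc 0) = A"
  by (rule eq_matI) auto

lemma kron_adjoint: "mat_adjoint (A \<otimes>\<^sub>k B) = mat_adjoint A \<otimes>\<^sub>k mat_adjoint B"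
  by (rule eq_matI) (auto simp: div_mod_less)

lemma kron_smult_left: "(c \<cdot>\<^sub>m A) \<otimes>\<^sub>k B = c \<cdot>\<^sub>m (A \<otimes>\<^sub>k B)"
  by (rule eq_matI) (auto simp: div_mod_less)

lemma kron_smult_right: "A \<otimes>\<^sub>k (c \<cdot>\<^sub>m B) = c \<cdot>\<^sub>m (A \<otimes>\<^sub>k B)"
  by (rule eq_matI) (auto simp: div_mod_less)

lemma kron_add_left:
  "A \<in> carrier_mat m n \<Longrightarrow> A' \<in> carrier_mat m n \<Longrightarrow> (A + A') \<otimes>\<^sub>k B = A \<otimes>\<^sub>k B + A' \<otimes>\<^sub>k B"
  by (rule eq_matI) (auto simp: div_mod_less algebra_simps)

lemma kron_add_right:
  "B \<in> carrier_mat m n \<Longrightarrow> B' \<in> carrier_mat m n \<Longrightarrow> A \<otimes>\<^sub>k (B + B') = A \<otimes>\<^sub>k B + A \<otimes>\<^sub>k B'"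
  by (rule eq_matI) (auto simp: div_mod_less algebra_simps)

lemma kron_uminus_left: "(- A) \<otimes>\<^sub>k B = - (A \<otimes>\<^sub>k B :: complex mat)"
  by (rule eq_matI) (auto simp: div_mod_less)

lemma kron_uminus_right: "A \<otimes>\<^sub>k (- B) = - (A \<otimes>\<^sub>k B :: complex mat)"
  by (rule eq_matI) (auto simp: div_mod_less)

lemma smult_smult_mat: "k \<cdot>\<^sub>m (l \<cdot>\<^sub>m A) = (k * l) \<cdot>\<^sub>m (A :: 'a :: semigroup_mult mat)"
  by (rule eq_matI) (auto simp: mult.assoc)

section \<open>Two-by-two matrices in explicit entries\<close>

definition mat2 :: "'a \<Rightarrow> 'a \<Rightarrow> 'a \<Rightarrow> 'a \<Rightarrow> 'a mat" where
  "mat2 a b c d = mat 2 2 (\<lambda>(i, j). if i = 0 then (if j = 0 then a else b) else (if j = 0 then c else d))"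

lemma less_2_iff: "(i :: nat) < 2 \<longleftrightarrow> i = 0 \<or> i = 1" by auto

lemma mat2_carrier [simp]: "mat2 a b c d \<in> carrier_mat 2 2"
  by (simp add: mat2_def)

lemma mat2_dim [simp]: "dim_row (mat2 a b c d) = 2" "dim_col (mat2 a b c d) = 2"
  by (simp_all add: mat2_def)

lemma mat2_index [simp]:
  "mat2 a b c d $$ (0, 0) = a" "mat2 a b c d $$ (0, Suc 0) = b"
  "mat2 a b c d $$ (Suc 0, 0) = c" "mat2 a b c d $$ (Suc 0, Suc 0) = d"
  by (simp_all add: mat2_def)

lemma eq_mat2: "A \<in> carrier_mat 2 2 \<Longrightarrow> A = mat2 (A $$ (0,0)) (A $$ (0,1)) (A $$ (1,0)) (A $$ (1,1))"
  by (rule eq_matI) (auto simp: less_2_iff)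

lemma mat2_cases:
  assumes "A \<in> carrier_mat 2 2" obtains a b c d where "A = mat2 a b c d"
  using eq_mat2 [OF assms] that by blast

lemma mat2_eq_iff [simp]: "mat2 a b c d = mat2 a' b' c' d' \<longleftrightarrow> a = a' \<and> b = b' \<and> c = c' \<and> d = d'"
  by (metis mat2_index)

lemma mat2_mult [simp]:
  "mat2 a b c d * mat2 a' b' c' d' =
   mat2 (a * a' + b * c') (a * b' + b * d') (c * a' + d * c') (c * b' + d * d' :: 'a :: comm_semiring_1)"
  by (rule eq_matI) (auto simp: less_2_iff scalar_prod_def sum.atLeast0_lessThan_Suc_shift
      atLeast0LessThan numeral_2_eq_2 less_Suc_eq)

lemma mat2_add [simp]: "mat2 a b c d + mat2 a' b' c' d' = mat2 (a + a') (b + b') (c + c') (d + d')"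
  by (rule eq_matI) (auto simp: less_2_iff)

lemma mat2_uminus [simp]: "- mat2 a b c d = mat2 (- a) (- b) (- c) (- d)"
  by (rule eq_matI) (auto simp: less_2_iff)

lemma mat2_smult [simp]: "k \<cdot>\<^sub>m mat2 a b c d = mat2 (k * a) (k * b) (k * c) (k * d)"
  by (rule eq_matI) (auto simp: less_2_iff)

lemma mat2_adjoint [simp]: "mat_adjoint (mat2 a b c d) = mat2 (cnj a) (cnj c) (cnj b) (cnj d)"
  by (rule eq_matI) (auto simp: less_2_iff)

lemma one_mat2: "1\<^sub>m 2 = mat2 1 0 0 1"
  by (rule eq_matI) (auto simp: less_2_iff)

lemma trace_mat2 [simp]: "mat_trace (mat2 a b c d) = a + d"
  by (simp add: mat_trace_def numeral_2_eq_2)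

lemma pauli_mat2:
  "pauli_X = mat2 0 1 1 0" "pauli_Y = mat2 0 (- \<i>) \<i> 0" "pauli_Z = mat2 1 0 0 (- 1)"
  unfolding pauli_X_def pauli_Y_def pauli_Z_def
  by (rule eq_matI; auto simp: less_2_iff mat_of_rows_list_def)+

section \<open>Unitary operators\<close>

lemma mult_carrier_square [simp]:
  "A \<in> carrier_mat n n \<Longrightarrow> B \<in> carrier_mat n n \<Longrightarrow> A * B \<in> carrier_mat n n"
  by (rule mult_carrier_mat)

lemma uminus_mult_2 [simp]:
  fixes A B :: "complex mat"
  assumes "A \<in> carrier_mat 2 2" "B \<in> carrier_mat 2 2"
  shows "- A * B = - (A * B)" "A * - B = - (A * B)"
  using assms by auto

lemma unitary_mat2_iff:
  "unitary_op 2 (mat2 a b c d) \<longleftrightarrow>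
     mat2 a b c d * mat2 (cnj a) (cnj c) (cnj b) (cnj d) = mat2 1 0 0 1 \<and>
     mat2 (cnj a) (cnj c) (cnj b) (cnj d) * mat2 a b c d = mat2 1 0 0 1"
  by (simp add: unitary_op_def one_mat2)

lemma gen_pauli_mat2_iff:
  "gen_pauli (mat2 a b c d) \<longleftrightarrow>
     unitary_op 2 (mat2 a b c d) \<and> cnj a = a \<and> cnj c = b \<and> cnj b = c \<and> cnj d = d \<and> a + d = 0"
  by (simp add: gen_pauli_def)

lemma unitary_carrier [simp]: "unitary_op n U \<Longrightarrow> U \<in> carrier_mat n n"
  unfolding unitary_op_def by blast

lemma unitary_adjoint [simp]: "unitary_op n U \<Longrightarrow> unitary_op n (mat_adjoint U)"
  unfolding unitary_op_def by auto

lemma unitary_mult_adjoint [simp]: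
  "unitary_op n U \<Longrightarrow> U * mat_adjoint U = 1\<^sub>m n"
  "unitary_op n U \<Longrightarrow> mat_adjoint U * U = 1\<^sub>m n"
  unfolding unitary_op_def by blast+

lemma unitaryI:
  "U \<in> carrier_mat n n \<Longrightarrow> U * mat_adjoint U = 1\<^sub>m n \<Longrightarrow> mat_adjoint U * U = 1\<^sub>m n \<Longrightarrow> unitary_op n U"
  unfolding unitary_op_def by blast

lemma unitary_one: "unitary_op n (1\<^sub>m n)"
  by (rule unitaryI) auto

lemma unitary_kron:
  "unitary_op 2 U \<Longrightarrow> unitary_op 2 V \<Longrightarrow> unitary_op 4 (U \<otimes>\<^sub>k V)"
  by (rule unitaryI) (simp_all add: kron_adjoint kron_mult [of _ 2 2 _ 2 2 _ 2 _ 2] kron_one_one)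

lemma unitary_cancel_left:
  assumes "unitary_op n U" "A \<in> carrier_mat n m"
  shows "mat_adjoint U * (U * A) = A" "U * (mat_adjoint U * A) = A"
proof -
  have c: "mat_adjoint U \<in> carrier_mat n n" "U \<in> carrier_mat n n"
    using assms by auto
  show "mat_adjoint U * (U * A) = A" "U * (mat_adjoint U * A) = A"
    using assms c assoc_mult_mat [OF c(1) c(2) assms(2)] assoc_mult_mat [OF c(2) c(1) assms(2)]
    by simp_all
qed

lemma unitary_cancel_right:
  assumes "unitary_op n U" "A \<in> carrier_mat m n"
  shows "A * U * mat_adjoint U = A" "A * mat_adjoint U * U = A"
proof -
  have c: "mat_adjoint U \<in> carrier_mat n n" "U \<in> carrier_mat n n"
    using assms by auto
  show "A * U * mat_adjoint U = A" "A * mat_adjoint U * U = A"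
    using assms c assoc_mult_mat [OF assms(2) c(1) c(2)] assoc_mult_mat [OF assms(2) c(2) c(1)]
    by simp_all
qed

lemma unitary_mult:
  assumes U: "unitary_op n U" and V: "unitary_op n V"
  shows "unitary_op n (U * V)"
proof -
  have c: "U \<in> carrier_mat n n" "V \<in> carrier_mat n n"
    "mat_adjoint U \<in> carrier_mat n n" "mat_adjoint V \<in> carrier_mat n n"
    using U V by auto
  have "(U * V) * (mat_adjoint V * mat_adjoint U) = U * V * mat_adjoint V * mat_adjoint U"
    using c by (intro assoc_mult_mat [symmetric]) auto
  also have "\<dots> = 1\<^sub>m n"
    using U unitary_cancel_right(1) [OF V c(1)] by simp
  finally have 1: "(U * V) * (mat_adjoint V * mat_adjoint U) = 1\<^sub>m n" .
  have "(mat_adjoint V * mat_adjoint U) * (U * V) = mat_adjoint V * (mat_adjoint U * (U * V))"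
    using c by (intro assoc_mult_mat) auto
  also have "\<dots> = 1\<^sub>m n"
    using V unitary_cancel_left(1) [OF U c(2)] by simp
  finally show ?thesis
    using 1 c by (intro unitaryI) (simp_all add: mat_adjoint_mult [OF c(1,2)])
qed

text \<open>Conjugation of \<open>A\<close> to \<open>B\<close> by \<open>V\<close> is written
  \<open>V * A = B * V\<close>, without an inverse, so that such relations compose by associativity
  alone.\<close>

lemma intertwine_trans:
  assumes "A \<in> carrier_mat n n" "B \<in> carrier_mat n n" "C \<in> carrier_mat n n"
    and "V \<in> carrier_mat n n" "W \<in> carrier_mat n n" and "V * A = B * V" "W * B = C * W"
  shows "(W * V) * A = C * (W * V)"
proof -
  have "(W * V) * A = W * (B * V)" using assms by (simp add: assoc_mult_mat [of _ n n _ n _ n])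
  also have "\<dots> = (C * W) * V" using assms by (simp flip: assoc_mult_mat [of _ n n _ n _ n])
  also have "\<dots> = C * (W * V)" using assms by (intro assoc_mult_mat) auto
  finally show ?thesis .
qed

lemma intertwine_adjoint:
  assumes W: "unitary_op n W" and B: "B \<in> carrier_mat n n" and C: "C \<in> carrier_mat n n"
    and WB: "W * B = C * W"
  shows "mat_adjoint W * C = B * mat_adjoint W"
proof -
  have c: "W \<in> carrier_mat n n" "mat_adjoint W \<in> carrier_mat n n"
    using W by auto
  have "mat_adjoint W * C = mat_adjoint W * (C * W * mat_adjoint W)"
    using unitary_cancel_right(1) [OF W C] by simp
  also have "\<dots> = mat_adjoint W * (W * (B * mat_adjoint W))"
    using c B by (simp add: assoc_mult_mat [of _ n n _ n _ n] flip: WB)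
  also have "\<dots> = B * mat_adjoint W"
    using W B c by (intro unitary_cancel_left(1)) auto
  finally show ?thesis .
qed

section \<open>Generalized Paulis\<close>

text \<open>Hermiticity makes the diagonal real and the off-diagonal entries conjugate, and the zero
  trace makes the diagonal entries opposite. The equation says that the Bloch vector (Re
  \<open>w\<close>, - Im \<open>w\<close>, \<open>c\<close>) has length one.\<close>

lemma gen_pauli_cases:
  assumes "gen_pauli P"
  obtains c :: real and w where "P = mat2 (of_real c) w (cnj w) (- of_real c)"
    and "of_real c * of_real c + w * cnj w = 1"
proof -
  obtain a b c d where P: "P = mat2 a b c d"
    using assms unfolding gen_pauli_def unitary_op_def by (blast elim: mat2_cases)
  from assms have "cnj a = a" and c: "c = cnj b" and d: "d = - a" "a * a + b * cnj b = 1"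
    unfolding P gen_pauli_def unitary_op_def one_mat2
    by (auto simp: add_eq_0_iff)
  then obtain r where "a = of_real r"
    by (metis Reals_cnj_iff Reals_cases)
  with that [of r b] c d show ?thesis by (simp add: P)
qed

lemma gen_pauliI:
  assumes "of_real c * of_real c + w * cnj w = (1 :: complex)"
  shows "gen_pauli (mat2 (of_real c) w (cnj w) (- of_real c))"
  using assms unfolding gen_pauli_def unitary_op_def one_mat2
  by (auto simp: algebra_simps)

lemma gen_pauli_carrier [simp]: "gen_pauli P \<Longrightarrow> P \<in> carrier_mat 2 2"
  and gen_pauli_unitary [simp]: "gen_pauli P \<Longrightarrow> unitary_op 2 P"
  and gen_pauli_adjoint [simp]: "gen_pauli P \<Longrightarrow> mat_adjoint P = P"
  and gen_pauli_trace [simp]: "gen_pauli P \<Longrightarrow> mat_trace P = 0"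
  unfolding gen_pauli_def unitary_op_def by blast+

lemma gen_pauli_square [simp]: "gen_pauli P \<Longrightarrow> P * P = 1\<^sub>m 2"
  by (metis gen_pauli_def unitary_op_def)

lemma gen_pauli_XYZ [simp]: "gen_pauli pauli_X" "gen_pauli pauli_Y" "gen_pauli pauli_Z"
  by (simp_all add: pauli_mat2 gen_pauli_mat2_iff unitary_mat2_iff)

lemma gen_pauli_uminus [simp]: "gen_pauli P \<Longrightarrow> gen_pauli (- P)"
  by (elim gen_pauli_cases) (simp add: gen_pauli_mat2_iff unitary_mat2_iff algebra_simps)

lemma mat_trace_cyclic:
  "A \<in> carrier_mat 2 2 \<Longrightarrow> B \<in> carrier_mat 2 2 \<Longrightarrow> mat_trace (A * B) = mat_trace (B * A)"
  by (elim mat2_cases) (simp add: algebra_simps)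

text \<open>The scalar is twice the inner product of the two Bloch vectors.\<close>

lemma gen_pauli_anticommutator:
  assumes "gen_pauli P" "gen_pauli Q"
  obtains c where "P * Q + Q * P = c \<cdot>\<^sub>m 1\<^sub>m 2"
  using assms by (elim gen_pauli_cases) (auto simp: one_mat2 algebra_simps)

text \<open>Both matrices square to the identity, which forces \<open>k * k = 1\<close>.\<close>

lemma gen_pauli_collinear:
  assumes P: "gen_pauli P" and "gen_pauli Q" and Q: "Q = k \<cdot>\<^sub>m P"
  shows "Q = P \<or> Q = - P" "k = 1 \<or> k = - 1"
proof -
  obtain c :: real and w where Pm: "P = mat2 (of_real c) w (cnj w) (- of_real c)"
    and n: "of_real c * of_real c + w * cnj w = 1"
    using P by (rule gen_pauli_cases)
  have "Q * Q = 1\<^sub>m 2" using assms by simp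
  then have "k * k * (of_real c * of_real c + w * cnj w) = 1"
    by (simp add: Q Pm one_mat2 algebra_simps)
  then have "k * k = 1" by (simp add: n)
  then show k: "k = 1 \<or> k = - 1" by (simp add: square_eq_1_iff)
  then show "Q = P \<or> Q = - P" by (auto simp: Q Pm)
qed

text \<open>For commuting matrices the anticommutator is twice the product, so \<open>P * Q\<close>
  is scalar. Multiplying by \<open>P\<close>, which is its own inverse, turns \<open>Q\<close> into
  a multiple of \<open>P\<close>.\<close>

lemma gen_pauli_commute:
  assumes "gen_pauli P" "gen_pauli Q" "P * Q = Q * P"
  shows "Q = P \<or> Q = - P"
proof -
  obtain c where "P * Q + Q * P = c \<cdot>\<^sub>m 1\<^sub>m 2" using gen_pauli_anticommutator assms by blast
  then have s: "P * Q + P * Q = c \<cdot>\<^sub>m 1\<^sub>m 2" using assms(3) by simp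
  have "P * Q \<in> carrier_mat 2 2" using assms(1,2) by simp
  then obtain p q r t where e: "P * Q = mat2 p q r t" by (rule mat2_cases)
  have PQ: "P * Q = (c / 2) \<cdot>\<^sub>m 1\<^sub>m 2"
    using s unfolding e one_mat2 by auto
  have "Q = P * (P * Q)"
    using unitary_cancel_left(1) [of 2 P Q 2] assms by simp
  also have "\<dots> = (c / 2) \<cdot>\<^sub>m P"
    using assms(1,2) by (simp add: PQ mult_smult_distrib [of _ 2 2 _ 2] right_mult_one_mat [of _ 2 2])
  finally show ?thesis
    using gen_pauli_collinear(1) assms by blast
qed

text \<open>The matrix \<open>1 + Z P\<close> does it, since
  \<open>(1 + Z P) P = P + Z = Z (1 + Z P)\<close>; it only has to be normalised. It vanishes
  exactly for \<open>P = - Z\<close>, that is for \<open>c = - 1\<close>, where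
  \<open>pauli_X\<close> serves instead.\<close>

lemma gen_pauli_diagonalize:
  assumes "gen_pauli P"
  obtains V where "unitary_op 2 V" "V * P = pauli_Z * V"
proof -
  obtain c :: real and w where P: "P = mat2 (of_real c) w (cnj w) (- of_real c)"
    and n: "of_real c * of_real c + w * cnj w = 1"
    using assms gen_pauli_cases by blast
  have n': "c * c + (cmod w)\<^sup>2 = 1"
  proof -
    have "complex_of_real (c * c + (cmod w)\<^sup>2) = 1"
      using n complex_norm_square [of w] by simp
    then show ?thesis by (simp only: of_real_eq_1_iff)
  qed
  show ?thesis
  proof (cases "c = - 1")
    case True
    then have "w = 0" using n by simp
    then show ?thesis
      using True P by (intro that [of pauli_X]) (simp_all add: pauli_mat2(1,3) unitary_mat2_iff)
  next
    case False
    have "c\<^sup>2 \<le> 1" using n' unfolding power2_eq_square by (metis le_add_same_cancel1 zero_le_square)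
    then have "- 1 \<le> c" using abs_square_le_1 [of c] by linarith
    with False have c: "0 < 2 * (1 + c)" by simp
    define N where "N = sqrt (2 * (1 + c))"
    have N: "complex_of_real N * complex_of_real N = 2 * (1 + of_real c)" "N \<noteq> 0"
    proof -
      have "complex_of_real (N * N) = of_real (2 * (1 + c))" "N \<noteq> 0" using c by (simp_all add: N_def)
      then show "complex_of_real N * complex_of_real N = 2 * (1 + of_real c)" "N \<noteq> 0" by simp_all
    qed
    have w: "w * cnj w = 1 - of_real c * of_real c"
      using n by (simp add: algebra_simps)
    define k where "k = 1 / complex_of_real N"
    have k: "cnj k = k" "k * k * (2 * (1 + of_real c)) = 1"
      unfolding N(1) [symmetric] using N(2) by (simp_all add: k_def)
    \<comment> \<open>This is \<open>1 + Z P\<close> divided by \<open>N\<close>, where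
      \<open>N * N = 2 * (1 + c)\<close> is the sum of the squared moduli of a row.\<close>
    define V where "V = k \<cdot>\<^sub>m mat2 (1 + of_real c) w (- cnj w) (1 + of_real c)"
    have "(1 + complex_of_real c) * (1 + of_real c) + w * cnj w = 2 * (1 + of_real c)"
      using w by (simp add: algebra_simps)
    then have "k * k * ((1 + complex_of_real c) * (1 + of_real c) + w * cnj w) = 1"
      using k by simp
    then have "unitary_op 2 V"
      using k(1) by (simp add: V_def unitary_mat2_iff algebra_simps)
    moreover have "k * (w * cnj w) = k - k * (of_real c * of_real c)"
      by (simp add: w right_diff_distrib)
    then have "V * P = pauli_Z * V"
      by (simp add: V_def P pauli_mat2 algebra_simps)
    ultimately show ?thesis using that by blast
  qed
qed

lemma gen_pauli_conjugate:
  assumes "gen_pauli P" "gen_pauli Q"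
  obtains U where "unitary_op 2 U" "U * P = Q * U"
proof -
  obtain V where V: "unitary_op 2 V" "V * P = pauli_Z * V"
    using gen_pauli_diagonalize assms by blast
  obtain W where W: "unitary_op 2 W" "W * Q = pauli_Z * W"
    using gen_pauli_diagonalize assms by blast
  have "mat_adjoint W * pauli_Z = Q * mat_adjoint W"
    using W assms by (intro intertwine_adjoint) auto
  then have "mat_adjoint W * V * P = Q * (mat_adjoint W * V)"
    using V W assms by (intro intertwine_trans [where n = 2 and B = pauli_Z]) auto
  then show ?thesis
    using that [of "mat_adjoint W * V"] V W by (simp add: unitary_mult)
qed

text \<open>Once \<open>P\<close> has become \<open>pauli_Z\<close>, the image \<open>R\<close> of
  \<open>Q\<close> anticommutes with \<open>pauli_Z\<close>, hence has zero diagonal. Only a phase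
  is left off the diagonal, and a diagonal unitary removes it.\<close>

lemma gen_pauli_pair_standard:
  assumes "gen_pauli P" "gen_pauli Q" and ac: "P * Q = - (Q * P)"
  obtains V where "unitary_op 2 V" "V * P = pauli_Z * V" "V * Q = pauli_X * V"
proof -
  obtain V where V: "unitary_op 2 V" "V * P = pauli_Z * V"
    using gen_pauli_diagonalize assms by blast
  define R where "R = V * Q * mat_adjoint V"
  have c [simp]: "V \<in> carrier_mat 2 2" "mat_adjoint V \<in> carrier_mat 2 2"
    "P \<in> carrier_mat 2 2" "Q \<in> carrier_mat 2 2" "pauli_Z \<in> carrier_mat 2 2" "pauli_X \<in> carrier_mat 2 2"
    using V assms by auto
  have R [simp]: "R \<in> carrier_mat 2 2"
    unfolding R_def by (intro mult_carrier_mat [of _ 2 2 _ 2]) auto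
  have "unitary_op 2 R"
    unfolding R_def using V assms by (simp add: unitary_mult)
  have "mat_adjoint R = R"
    unfolding R_def using assms
    by (simp add: mat_adjoint_mult [of _ 2 2 _ 2] assoc_mult_mat [of _ 2 2 _ 2 _ 2])
  have RV: "V * Q = R * V"
    unfolding R_def using V by (subst unitary_cancel_right(2) [of 2 _ _ 2]) auto
  have "V * (P * Q) = pauli_Z * R * V"
    by (simp add: assoc_mult_mat [of _ 2 2 _ 2 _ 2] flip: RV)
      (simp add: V flip: assoc_mult_mat [of _ 2 2 _ 2 _ 2])
  moreover have "V * (Q * P) = R * pauli_Z * V"
    by (simp add: assoc_mult_mat [of _ 2 2 _ 2 _ 2] flip: V(2))
      (simp add: RV flip: assoc_mult_mat [of _ 2 2 _ 2 _ 2])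
  ultimately have "pauli_Z * R * V = - (R * pauli_Z) * V"
    using ac V(1) carrier_matD [OF R] carrier_matD [OF c(1)] carrier_matD [OF c(3)] carrier_matD [OF c(4)]
      carrier_matD [OF c(5)]
    by (simp add: uminus_mult_left_mat uminus_mult_right_mat)
  then have "pauli_Z * R * V * mat_adjoint V = - (R * pauli_Z) * V * mat_adjoint V" by simp
  then have ZR: "pauli_Z * R = - (R * pauli_Z)"
    by (subst (asm) (1 2) unitary_cancel_right [OF V(1), where m = 2]) auto
  obtain a b c d where Rm: "R = mat2 a b c d" using R mat2_cases by blast
  have Rb: "R = mat2 0 b (cnj b) 0" "b * cnj b = 1" 
    using \<open>unitary_op 2 R\<close> \<open>mat_adjoint R = R\<close> ZR unfolding Rm by (auto simp: pauli_mat2 unitary_mat2_iff)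
  \<comment> \<open>Being diagonal, \<open>D\<close> commutes with \<open>pauli_Z\<close>; its lower
    entry \<open>b\<close> cancels the phase of \<open>R\<close>.\<close>
  define D where "D = mat2 1 0 0 b"
  have D: "unitary_op 2 D" "D \<in> carrier_mat 2 2" "D * pauli_Z = pauli_Z * D" "D * R = pauli_X * D"
    using Rb by (auto simp: D_def unitary_mat2_iff pauli_mat2 mult.commute)
  show ?thesis
  proof (rule that [of "D * V"])
    show "unitary_op 2 (D * V)" using D V by (simp add: unitary_mult)
    show "D * V * P = pauli_Z * (D * V)"
      using D V by (intro intertwine_trans [where n = 2 and B = pauli_Z]) auto
    show "D * V * Q = pauli_X * (D * V)"
      using D RV by (intro intertwine_trans [where n = 2 and B = R]) auto
  qed
qed

text \<open>Anticommuting pairs are orthonormal pairs of Bloch vectors, and a rotation takes any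
  such pair to any other. The rotation passes through the standard pair \<open>pauli_Z\<close>,
  \<open>pauli_X\<close>.\<close>

lemma gen_pauli_pair_conjugate:
  assumes "gen_pauli P" "gen_pauli Q" "P * Q = - (Q * P)"
    and "gen_pauli P'" "gen_pauli Q'" "P' * Q' = - (Q' * P')"
  obtains U where "unitary_op 2 U" "U * P = P' * U" "U * Q = Q' * U"
proof -
  obtain V where V: "unitary_op 2 V" "V * P = pauli_Z * V" "V * Q = pauli_X * V"
    using gen_pauli_pair_standard assms by blast
  obtain W where W: "unitary_op 2 W" "W * P' = pauli_Z * W" "W * Q' = pauli_X * W"
    using gen_pauli_pair_standard assms by blast
  have *: "mat_adjoint W * V * A = B * (mat_adjoint W * V)"
    if "gen_pauli A" "gen_pauli B" "gen_pauli C" "V * A = C * V" "W * B = C * W" for A B C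
    using that V W by (intro intertwine_trans [where n = 2 and B = C] intertwine_adjoint) auto
  show ?thesis
    using that [of "mat_adjoint W * V"] * [of P P' pauli_Z] * [of Q Q' pauli_X] V W assms
    by (simp add: unitary_mult)
qed

text \<open>The commutator is \<open>2 * \<i>\<close> times the Hermitian matrix of the cross
  product of the two Bloch vectors. That vector is nonzero unless the matrices commute, and \<gamma>
  normalises it.\<close>

lemma gen_pauli_commutator:
  assumes "gen_pauli P" "gen_pauli Q" "Q \<noteq> P" "Q \<noteq> - P"
  obtains \<gamma> where "gen_pauli (\<gamma> \<cdot>\<^sub>m (P * Q - Q * P))"
proof -
  obtain c :: real and w where P: "P = mat2 (of_real c) w (cnj w) (- of_real c)"
    using assms(1) by (rule gen_pauli_cases)
  obtain d :: real and v where Q: "Q = mat2 (of_real d) v (cnj v) (- of_real d)"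
    using assms(2) by (rule gen_pauli_cases)
  \<comment> \<open>\<open>r\<close> and \<open>u\<close> are the entries of the matrix of the cross
    product, and \<open>m\<close> is its length.\<close>
  define r where "r = Im (w * cnj v)"
  define u where "u = - \<i> * (of_real c * v - of_real d * w)"
  define m where "m = sqrt (r\<^sup>2 + (cmod u)\<^sup>2)"
  have i: "w * cnj v - v * cnj w = 2 * \<i> * of_real r"
    by (simp add: r_def complex_eq_iff)
  have c: "P * Q - Q * P = (2 * \<i>) \<cdot>\<^sub>m mat2 (of_real r) u (cnj u) (- of_real r)"
    using i by (simp add: P Q u_def minus_add_uminus_mat [of _ 2 2] algebra_simps)
  have "m \<noteq> 0"
  proof
    assume "m = 0"
    then have "r = 0" "u = 0" by (auto simp: m_def real_sqrt_eq_0_iff sum_power2_eq_zero_iff)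
    then have "P * Q = Q * P"
      using c by (simp add: P Q minus_add_uminus_mat [of _ 2 2]) (auto simp: algebra_simps)
    with gen_pauli_commute assms show False by blast
  qed
  have m: "complex_of_real m * complex_of_real m = of_real (r * r) + u * cnj u"
  proof -
    have "complex_of_real (m * m) = complex_of_real (r * r + (cmod u)\<^sup>2)"
      by (simp add: m_def power2_eq_square)
    then show ?thesis using complex_norm_square [of u] by simp
  qed
  have "gen_pauli (mat2 (of_real (r / m)) (u / of_real m) (cnj (u / of_real m)) (- of_real (r / m)))"
  proof (rule gen_pauliI)
    have "complex_of_real (r / m) * of_real (r / m) + u / of_real m * cnj (u / of_real m) =
        (of_real (r * r) + u * cnj u) / (of_real m * of_real m)"
      by (simp add: add_divide_distrib)
    also have "\<dots> = 1" unfolding m [symmetric] using \<open>m \<noteq> 0\<close> by simp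
    finally show "complex_of_real (r / m) * of_real (r / m) + u / of_real m * cnj (u / of_real m) = 1" .
  qed
  also have "mat2 (of_real (r / m)) (u / of_real m) (cnj (u / of_real m)) (- of_real (r / m)) =
      (1 / (2 * \<i> * of_real m)) \<cdot>\<^sub>m (P * Q - Q * P)"
    by (simp add: c)
  finally show ?thesis using that by blast
qed

section \<open>Conjugation of the register algebra\<close>

lemma less_4_iff: "(i :: nat) < 4 \<longleftrightarrow> i = 0 \<or> i = 1 \<or> i = 2 \<or> i = 3" by auto

lemma sum_less_4: "(\<Sum>k = 0..<4 :: nat. f k) = f 0 + f 1 + f 2 + (f 3 :: 'a :: comm_monoid_add)"
  by (simp add: eval_nat_numeral add.assoc)

lemma mult_index_4:
  "A \<in> carrier_mat 4 4 \<Longrightarrow> B \<in> carrier_mat 4 4 \<Longrightarrow> i < 4 \<Longrightarrow> j < 4 \<Longrightarrow>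
   (A * B) $$ (i, j) = A $$ (i, 0) * B $$ (0, j) + A $$ (i, 1) * B $$ (1, j)
     + A $$ (i, 2) * B $$ (2, j) + A $$ (i, 3) * (B $$ (3, j) :: 'a :: comm_semiring_1)"
  by (simp add: scalar_prod_def sum_less_4)

lemma kron_mat2_index:
  "mat2 a b c d \<otimes>\<^sub>k mat2 p q r s = mat 4 4 (\<lambda>(i, j).
     [[a * p, a * q, b * p, b * q], [a * r, a * s, b * r, b * s],
      [c * p, c * q, d * p, d * q], [c * r, c * s, d * r, d * s]] ! i ! j)"
  by (rule eq_matI) (auto simp: less_4_iff)

lemma kron_one_cancel_left:
  assumes "A \<in> carrier_mat 2 2" "B \<in> carrier_mat 2 2" "1\<^sub>m 2 \<otimes>\<^sub>k A = 1\<^sub>m 2 \<otimes>\<^sub>k B"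
  shows "A = B"
proof -
  have "(1\<^sub>m 2 \<otimes>\<^sub>k A) $$ (i, j) = (1\<^sub>m 2 \<otimes>\<^sub>k B) $$ (i, j)" for i j
    using assms(3) by simp
  from this [of 0 0] this [of 0 1] this [of 1 0] this [of 1 1] show ?thesis
    using assms(1,2) by (elim mat2_cases) (simp add: one_mat2 kron_mat2_index)
qed

lemma kron_one_cancel_right:
  assumes "A \<in> carrier_mat 2 2" "B \<in> carrier_mat 2 2" "A \<otimes>\<^sub>k 1\<^sub>m 2 = B \<otimes>\<^sub>k 1\<^sub>m 2"
  shows "A = B"
proof -
  have "(A \<otimes>\<^sub>k 1\<^sub>m 2) $$ (i, j) = (B \<otimes>\<^sub>k 1\<^sub>m 2) $$ (i, j)" for i j
    using assms(3) by simp
  from this [of 0 0] this [of 0 2] this [of 2 0] this [of 2 2] show ?thesis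
    using assms(1,2) by (elim mat2_cases) (simp add: one_mat2 kron_mat2_index)
qed

lemma kron_scalar:
  assumes "A \<in> carrier_mat 2 2" "A \<otimes>\<^sub>k (b \<cdot>\<^sub>m 1\<^sub>m 2) = c \<cdot>\<^sub>m 1\<^sub>m 4"
  shows "b \<cdot>\<^sub>m A = c \<cdot>\<^sub>m 1\<^sub>m 2"
proof -
  have "(b \<cdot>\<^sub>m A) \<otimes>\<^sub>k 1\<^sub>m 2 = (c \<cdot>\<^sub>m 1\<^sub>m 2) \<otimes>\<^sub>k 1\<^sub>m 2"
    using assms(2) by (simp add: kron_smult_left kron_smult_right kron_one_one)
  then show ?thesis using assms(1) kron_one_cancel_right [of "b \<cdot>\<^sub>m A" "c \<cdot>\<^sub>m 1\<^sub>m 2"] by auto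
qed

lemma kron_scalar':
  assumes "B \<in> carrier_mat 2 2" "(a \<cdot>\<^sub>m 1\<^sub>m 2) \<otimes>\<^sub>k B = c \<cdot>\<^sub>m 1\<^sub>m 4"
  shows "a \<cdot>\<^sub>m B = c \<cdot>\<^sub>m 1\<^sub>m 2"
proof -
  have "1\<^sub>m 2 \<otimes>\<^sub>k (a \<cdot>\<^sub>m B) = 1\<^sub>m 2 \<otimes>\<^sub>k (c \<cdot>\<^sub>m 1\<^sub>m 2)"
    using assms(2) by (simp add: kron_smult_left kron_smult_right kron_one_one)
  then show ?thesis using assms(1) kron_one_cancel_left [of "a \<cdot>\<^sub>m B" "c \<cdot>\<^sub>m 1\<^sub>m 2"] by auto
qed

text \<open>Write \<open>R\<close> and \<open>R'\<close> as a/2 plus and minus a traceless \<rho>,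
  and \<open>S\<close> and \<open>S'\<close> as b/2 plus and minus a traceless \<sigma>. The mixed
  terms cancel and the sum is ab/2 plus twice \<rho> \<otimes> \<sigma>. If this is scalar, then
  \<rho> \<otimes> \<sigma> = 0, so \<rho> or \<sigma> vanishes.\<close>

lemma kron_scalar_dichotomy:
  assumes R: "R \<in> carrier_mat 2 2" "R' \<in> carrier_mat 2 2" "R + R' = a \<cdot>\<^sub>m 1\<^sub>m 2" "mat_trace R = a"
    and S: "S \<in> carrier_mat 2 2" "S' \<in> carrier_mat 2 2" "S + S' = b \<cdot>\<^sub>m 1\<^sub>m 2" "mat_trace S = b"
    and e: "R \<otimes>\<^sub>k S + R' \<otimes>\<^sub>k S' = c \<cdot>\<^sub>m 1\<^sub>m 4"
  shows "R = (a / 2) \<cdot>\<^sub>m 1\<^sub>m 2 \<or> S = (b / 2) \<cdot>\<^sub>m 1\<^sub>m 2"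
proof -
  obtain r1 r2 r3 r4 where Rm: "R = mat2 r1 r2 r3 r4" using R(1) by (rule mat2_cases)
  obtain r1' r2' r3' r4' where Rm': "R' = mat2 r1' r2' r3' r4'" using R(2) by (rule mat2_cases)
  obtain s1 s2 s3 s4 where Sm: "S = mat2 s1 s2 s3 s4" using S(1) by (rule mat2_cases)
  obtain s1' s2' s3' s4' where Sm': "S' = mat2 s1' s2' s3' s4'" using S(2) by (rule mat2_cases)
  define r where "r = (r1 - r4) / 2"
  define s where "s = (s1 - s4) / 2"
  have Rv: "r1 = a / 2 + r" "r4 = a / 2 - r" "r1' = a / 2 - r" "r2' = - r2" "r3' = - r3" "r4' = a / 2 + r"
    using R(3,4) unfolding Rm Rm' one_mat2 r_def by (auto simp: field_simps add_eq_0_iff2)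
  have Sv: "s1 = b / 2 + s" "s4 = b / 2 - s" "s1' = b / 2 - s" "s2' = - s2" "s3' = - s3" "s4' = b / 2 + s"
    using S(3,4) unfolding Sm Sm' one_mat2 s_def by (auto simp: field_simps add_eq_0_iff2)
  have ind: "(R \<otimes>\<^sub>k S + R' \<otimes>\<^sub>k S') $$ (i, j) = (c \<cdot>\<^sub>m 1\<^sub>m 4) $$ (i, j)" for i j
    using e by simp
  note eqs = ind [unfolded Rm Rm' Sm Sm' kron_mat2_index]
  \<comment> \<open>These are all nine products of an entry of \<rho> with an entry of \<sigma>. The
    product \<open>r * s\<close> comes from comparing two diagonal positions.\<close>
  have z: "r * s2 = 0" "r * s3 = 0" "r2 * s = 0" "r2 * s2 = 0" "r2 * s3 = 0"
     "r3 * s = 0" "r3 * s2 = 0" "r3 * s3 = 0" "r * s = - (r * s)"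
    using eqs [of 0 1] eqs [of 1 0] eqs [of 0 2] eqs [of 0 3] eqs [of 1 2]
      eqs [of 2 0] eqs [of 2 1] eqs [of 3 0] eqs [of 0 0] eqs [of 1 1]
    by (simp_all add: Rv Sv field_simps)
  then show ?thesis
    by (auto simp: Rm Sm one_mat2 Rv Sv)
qed

text \<open>When one tensor factor is the same scalar in both terms, the combination collapses onto
  the other factor. With \<open>l = - 1\<close> this computes the image of a commutator.\<close>

lemma kron_scalar_combination:
  fixes X Y :: "complex mat"
  assumes "X \<in> carrier_mat 2 2" "Y \<in> carrier_mat 2 2"
  shows "\<gamma> \<cdot>\<^sub>m ((k \<cdot>\<^sub>m 1\<^sub>m 2) \<otimes>\<^sub>k X + l \<cdot>\<^sub>m ((k \<cdot>\<^sub>m 1\<^sub>m 2) \<otimes>\<^sub>k Y)) = 1\<^sub>m 2 \<otimes>\<^sub>k ((\<gamma> * k) \<cdot>\<^sub>m (X + l \<cdot>\<^sub>m Y))"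
    and "\<gamma> \<cdot>\<^sub>m (X \<otimes>\<^sub>k (k \<cdot>\<^sub>m 1\<^sub>m 2) + l \<cdot>\<^sub>m (Y \<otimes>\<^sub>k (k \<cdot>\<^sub>m 1\<^sub>m 2))) = ((\<gamma> * k) \<cdot>\<^sub>m (X + l \<cdot>\<^sub>m Y)) \<otimes>\<^sub>k 1\<^sub>m 2"
  using assms
  by (elim mat2_cases; intro eq_matI;
      auto simp: one_mat2 kron_mat2_index less_4_iff algebra_simps)+

text \<open>For unitary \<open>E\<close>, \<open>T\<close> is the image of
  \<open>1 \<otimes> M\<close> under conjugation by \<open>E\<close>. The lemmas below show that the
  passage from \<open>M\<close> to \<open>T\<close> is an injective homomorphism that respects
  adjoints.\<close>

definition transports :: "complex mat \<Rightarrow> complex mat \<Rightarrow> complex mat \<Rightarrow> bool" where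
  "transports E M T \<longleftrightarrow> M \<in> carrier_mat 2 2 \<and> T \<in> carrier_mat 4 4 \<and> E * (1\<^sub>m 2 \<otimes>\<^sub>k M) = T * E"

lemma transports_mult:
  assumes E: "E \<in> carrier_mat 4 4" and "transports E M T" "transports E M' T'"
  shows "transports E (M * M') (T * T')"
proof -
  have c [simp]: "M \<in> carrier_mat 2 2" "T \<in> carrier_mat 4 4" "E * (1\<^sub>m 2 \<otimes>\<^sub>k M) = T * E"
    "M' \<in> carrier_mat 2 2" "T' \<in> carrier_mat 4 4" "E * (1\<^sub>m 2 \<otimes>\<^sub>k M') = T' * E"
    using assms by (auto simp: transports_def)
  have "E * (1\<^sub>m 2 \<otimes>\<^sub>k (M * M')) = E * ((1\<^sub>m 2 \<otimes>\<^sub>k M) * (1\<^sub>m 2 \<otimes>\<^sub>k M'))"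
    by (simp add: kron_mult [of _ 2 2 _ 2 2 _ 2 _ 2])
  also have "\<dots> = T * E * (1\<^sub>m 2 \<otimes>\<^sub>k M')"
    using E by (simp flip: assoc_mult_mat [of _ 4 4 _ 4 _ 4])
  also have "\<dots> = T * T' * E"
    using E by (simp add: assoc_mult_mat [of _ 4 4 _ 4 _ 4])
  finally show ?thesis by (simp add: transports_def)
qed

lemma transports_add:
  assumes "E \<in> carrier_mat 4 4" "transports E M T" "transports E M' T'"
  shows "transports E (M + M') (T + T')"
  using assms
  by (auto simp: transports_def kron_add_right [of _ 2 2] mult_add_distrib_mat [of _ 4 4 _ 4]
      add_mult_distrib_mat [of _ 4 4 _ _ 4])

lemma transports_smult:
  assumes "E \<in> carrier_mat 4 4" "transports E M T"
  shows "transports E (k \<cdot>\<^sub>m M) (k \<cdot>\<^sub>m T)"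
  using assms
  by (auto simp: transports_def kron_smult_right mult_smult_distrib [of _ 4 4 _ 4]
      mult_smult_assoc_mat [of _ 4 4 _ 4])

lemma transports_uminus:
  assumes "E \<in> carrier_mat 4 4" "transports E M T"
  shows "transports E (- M) (- T)"
proof -
  have "(- 1) \<cdot>\<^sub>m A = - A" for A :: "complex mat" by (rule eq_matI) auto
  then show ?thesis using transports_smult [OF assms, of "- 1"] by simp
qed

lemma transports_one: "E \<in> carrier_mat 4 4 \<Longrightarrow> transports E (1\<^sub>m 2) (1\<^sub>m 4)"
  by (simp add: transports_def kron_one_one right_mult_one_mat [of _ 4 4] left_mult_one_mat [of _ 4 4])

lemma transports_adjoint:
  assumes E: "unitary_op 4 E" and MT: "transports E M T"
  shows "transports E (mat_adjoint M) (mat_adjoint T)"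
proof -
  have c [simp]: "M \<in> carrier_mat 2 2" "T \<in> carrier_mat 4 4" "E \<in> carrier_mat 4 4"
    "mat_adjoint E \<in> carrier_mat 4 4" "1\<^sub>m 2 \<otimes>\<^sub>k mat_adjoint M \<in> carrier_mat 4 4"
    using E MT by (auto simp: transports_def)
  have "mat_adjoint (E * (1\<^sub>m 2 \<otimes>\<^sub>k M)) = mat_adjoint (T * E)"
    using MT by (simp add: transports_def)
  then have *: "1\<^sub>m 2 \<otimes>\<^sub>k mat_adjoint M * mat_adjoint E = mat_adjoint E * mat_adjoint T"
    by (simp add: mat_adjoint_mult [of _ 4 4 _ 4] kron_adjoint)
  have "mat_adjoint (mat_adjoint E) * (1\<^sub>m 2 \<otimes>\<^sub>k mat_adjoint M) = mat_adjoint T * mat_adjoint (mat_adjoint E)"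
    using E by (intro intertwine_adjoint [OF _ _ _ *[symmetric]]) auto
  then show ?thesis by (simp add: transports_def)
qed

lemma transports_unique:
  assumes E: "unitary_op 4 E" and "transports E M T" "transports E M T'"
  shows "T = T'"
proof -
  have "T * E * mat_adjoint E = T' * E * mat_adjoint E"
    using assms by (simp add: transports_def)
  moreover have "T \<in> carrier_mat 4 4" "T' \<in> carrier_mat 4 4"
    using assms by (auto simp: transports_def)
  ultimately show ?thesis
    by (metis unitary_cancel_right(1) [OF E])
qed

lemma transports_inj:
  assumes E: "unitary_op 4 E" and "transports E M T" "transports E M' T"
  shows "M = M'"
proof -
  have "mat_adjoint E * (E * (1\<^sub>m 2 \<otimes>\<^sub>k M)) = mat_adjoint E * (E * (1\<^sub>m 2 \<otimes>\<^sub>k M'))"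
    using assms by (simp add: transports_def)
  then have "1\<^sub>m 2 \<otimes>\<^sub>k M = 1\<^sub>m 2 \<otimes>\<^sub>k M'"
    using assms by (subst (asm) (1 2) unitary_cancel_left(1) [OF E, where m = 4])
      (auto simp: transports_def)
  then show ?thesis using assms kron_one_cancel_left by (auto simp: transports_def)
qed

text \<open>\<open>pauli_X\<close> and \<open>pauli_Z\<close> generate all two-by-two matrices, so
  \<open>G\<close> lies in the commutant of the register algebra. In entries, commuting with Z
  removes the positions where the two register indices differ, and commuting with X equates the
  remaining two blocks.\<close>

lemma commutes_with_right_factor:
  assumes G: "G \<in> carrier_mat 4 4"
    and X: "G * (1\<^sub>m 2 \<otimes>\<^sub>k pauli_X) = (1\<^sub>m 2 \<otimes>\<^sub>k pauli_X) * G"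
    and Z: "G * (1\<^sub>m 2 \<otimes>\<^sub>k pauli_Z) = (1\<^sub>m 2 \<otimes>\<^sub>k pauli_Z) * G"
  obtains V where "V \<in> carrier_mat 2 2" "G = V \<otimes>\<^sub>k 1\<^sub>m 2"
proof (rule that)
  let ?V = "mat2 (G $$ (0, 0)) (G $$ (0, 2)) (G $$ (2, 0)) (G $$ (2, 2))"
  show "?V \<in> carrier_mat 2 2" by simp
  have cX: "1\<^sub>m 2 \<otimes>\<^sub>k pauli_X \<in> carrier_mat 4 4" and cZ: "1\<^sub>m 2 \<otimes>\<^sub>k pauli_Z \<in> carrier_mat 4 4"
    by (simp_all add: pauli_mat2)
  have "(G * (1\<^sub>m 2 \<otimes>\<^sub>k pauli_Z)) $$ (i, j) = ((1\<^sub>m 2 \<otimes>\<^sub>k pauli_Z) * G) $$ (i, j)" for i j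
    using Z by simp
  note z = this
  have off: "G $$ (0, 1) = 0" "G $$ (1, 0) = 0" "G $$ (0, 3) = 0" "G $$ (1, 2) = 0"
    "G $$ (2, 1) = 0" "G $$ (3, 0) = 0" "G $$ (2, 3) = 0" "G $$ (3, 2) = 0"
    using z [of 0 1] z [of 1 0] z [of 0 3] z [of 1 2] z [of 2 1] z [of 3 0] z [of 2 3] z [of 3 2]
    by (simp_all add: mult_index_4 [OF G cZ] mult_index_4 [OF cZ G])
       (simp_all add: pauli_mat2 one_mat2 kron_mat2_index)
  have "(G * (1\<^sub>m 2 \<otimes>\<^sub>k pauli_X)) $$ (i, j) = ((1\<^sub>m 2 \<otimes>\<^sub>k pauli_X) * G) $$ (i, j)" for i j
    using X by simp
  note x = this
  have dia: "G $$ (1, 1) = G $$ (0, 0)" "G $$ (1, 3) = G $$ (0, 2)"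
    "G $$ (3, 1) = G $$ (2, 0)" "G $$ (3, 3) = G $$ (2, 2)"
    using x [of 0 1] x [of 0 3] x [of 2 1] x [of 2 3]
    by (simp_all add: mult_index_4 [OF G cX] mult_index_4 [OF cX G])
       (simp_all add: pauli_mat2 one_mat2 kron_mat2_index)
  show "G = ?V \<otimes>\<^sub>k 1\<^sub>m 2"
    using G off dia by (intro eq_matI) (auto simp: one_mat2 kron_mat2_index less_4_iff)
qed

text \<open>If \<open>E\<close> and \<open>F\<close> have the same images after the register has
  been rotated by \<open>V\<close>, then \<open>E\<close> followed by the inverse of
  \<open>F\<close> fixes the rotated register algebra, and so acts on the ancilla alone.\<close>

lemma factor_from_transport:
  assumes E: "unitary_op 4 E" and F: "unitary_op 4 F" and V: "unitary_op 2 V"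
    and P: "transports E P T" "transports F pauli_X T" "V * P = pauli_X * V"
    and Q: "transports E Q T'" "transports F pauli_Z T'" "V * Q = pauli_Z * V"
  obtains V' where "unitary_op 2 V'" "E = F * (V' \<otimes>\<^sub>k V)"
proof -
  let ?I = "1\<^sub>m 2 :: complex mat"
  define G where "G = mat_adjoint F * E * (?I \<otimes>\<^sub>k mat_adjoint V)"
  have cE [simp]: "E \<in> carrier_mat 4 4" "F \<in> carrier_mat 4 4" "mat_adjoint F \<in> carrier_mat 4 4"
    "V \<in> carrier_mat 2 2" "mat_adjoint V \<in> carrier_mat 2 2"
    using assms by auto
  have uI: "unitary_op 4 (?I \<otimes>\<^sub>k V)" "unitary_op 4 (?I \<otimes>\<^sub>k mat_adjoint V)"
    using V by (auto intro!: unitary_kron simp: unitary_one)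
  have uG: "unitary_op 4 G"
    unfolding G_def using assms by (auto intro!: unitary_mult unitary_kron simp: unitary_one)
  \<comment> \<open>Three intertwiners in a row: the adjoint of \<open>V\<close> takes
    \<open>A\<close> to \<open>M\<close>, \<open>E\<close> takes \<open>M\<close> to the common
    image \<open>R\<close>, and the adjoint of \<open>F\<close> takes \<open>R\<close> back to
    \<open>A\<close>.\<close>
  have G: "G * (?I \<otimes>\<^sub>k A) = (?I \<otimes>\<^sub>k A) * G"
    if "transports E M R" "transports F A R" "V * M = A * V" for A M R
  proof -
    have [simp]: "M \<in> carrier_mat 2 2" "R \<in> carrier_mat 4 4" "A \<in> carrier_mat 2 2"
      and e: "E * (?I \<otimes>\<^sub>k M) = R * E" and f: "F * (?I \<otimes>\<^sub>k A) = R * F"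
      using that by (auto simp: transports_def)
    have "mat_adjoint V * A = M * mat_adjoint V"
      using V that(3) by (intro intertwine_adjoint) auto
    then have v: "(?I \<otimes>\<^sub>k mat_adjoint V) * (?I \<otimes>\<^sub>k A) = (?I \<otimes>\<^sub>k M) * (?I \<otimes>\<^sub>k mat_adjoint V)"
      by (simp add: kron_mult [of _ 2 2 _ 2 2 _ 2 _ 2])
    have f': "mat_adjoint F * R = (?I \<otimes>\<^sub>k A) * mat_adjoint F"
      using F f by (intro intertwine_adjoint) auto
    have FE: "mat_adjoint F * E * (?I \<otimes>\<^sub>k M) = (?I \<otimes>\<^sub>k A) * (mat_adjoint F * E)"
      by (rule intertwine_trans [where n = 4 and B = R]) (use e f' in auto)
    show ?thesis
      unfolding G_def by (rule intertwine_trans [where n = 4 and B = "?I \<otimes>\<^sub>k M"]) (use v FE in auto)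
  qed
  obtain V' where V': "V' \<in> carrier_mat 2 2" "G = V' \<otimes>\<^sub>k ?I"
    using commutes_with_right_factor [of G] G P Q uG by auto
  have uV': "unitary_op 2 V'"
  proof (rule unitaryI)
    have "mat_adjoint G * G = 1\<^sub>m 4" "G * mat_adjoint G = 1\<^sub>m 4" using uG by auto
    then have "(mat_adjoint V' * V') \<otimes>\<^sub>k ?I = ?I \<otimes>\<^sub>k ?I" "(V' * mat_adjoint V') \<otimes>\<^sub>k ?I = ?I \<otimes>\<^sub>k ?I"
      using V' by (simp_all add: kron_adjoint kron_one_one kron_mult [of _ 2 2 _ 2 2 _ 2 _ 2])
    then show "V' * mat_adjoint V' = 1\<^sub>m 2" "mat_adjoint V' * V' = 1\<^sub>m 2"
      using V' by (auto dest!: kron_one_cancel_right [rotated 2])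
  qed (rule V')
  have "F * (V' \<otimes>\<^sub>k V) = F * (G * (?I \<otimes>\<^sub>k V))"
    using V' by (simp add: kron_mult [of _ 2 2 _ 2 2 _ 2 _ 2] right_mult_one_mat [of _ 2 2] left_mult_one_mat [of _ 2 2])
  also have "G * (?I \<otimes>\<^sub>k V) = mat_adjoint F * E"
    unfolding G_def using unitary_cancel_right(2) [OF uI(1), of "mat_adjoint F * E" 4]
    by (simp add: kron_adjoint)
  also have "F * (mat_adjoint F * E) = E"
    using unitary_cancel_left(2) [OF F cE(1)] by simp
  finally have "F * (V' \<otimes>\<^sub>k V) = E" .
  from that [OF uV' this [symmetric]] show ?thesis .
qed

text \<open>Conjugation preserves adjoints and products, so the image of \<open>N\<close> is
  Hermitian and squares to the identity. The embedding \<open>f\<close> on either side is injective,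
  hence \<open>C\<close> inherits both properties.\<close>

lemma gen_pauli_of_transports:
  assumes E: "unitary_op 4 E" and N: "gen_pauli N" and C: "C \<in> carrier_mat 2 2" "mat_trace C = 0"
    and f: "f = (\<lambda>M. 1\<^sub>m 2 \<otimes>\<^sub>k M) \<or> f = (\<lambda>M. M \<otimes>\<^sub>k 1\<^sub>m 2)"
    and t: "transports E N (f C)"
  shows "gen_pauli C"
proof -
  have cE: "E \<in> carrier_mat 4 4" using E by simp
  have f_adj: "mat_adjoint (f C) = f (mat_adjoint C)" and f_mult: "f C * f C = f (C * C)"
    and f_one: "f (1\<^sub>m 2) = 1\<^sub>m 4"
    using f C by (auto simp: kron_adjoint kron_one_one kron_mult [of _ 2 2 _ 2 2 _ 2 _ 2])
  have f_inj: "X = Y" if "f X = f Y" "X \<in> carrier_mat 2 2" "Y \<in> carrier_mat 2 2" for X Y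
    using f that kron_one_cancel_left kron_one_cancel_right by blast
  have "transports E N (f (mat_adjoint C))"
    using transports_adjoint [OF E t] N f_adj by simp
  then have adj: "mat_adjoint C = C"
    using transports_unique [OF E t] f_inj [of C "mat_adjoint C"] C by auto
  have "transports E (1\<^sub>m 2) (f (C * C))"
    using transports_mult [OF cE t t] N f_mult by simp
  then have "f (C * C) = f (1\<^sub>m 2)"
    using transports_unique [OF E transports_one [OF cE]] f_one by simp
  then have "C * C = 1\<^sub>m 2" using f_inj C by auto
  then have "unitary_op 2 C" using unitaryI [OF C(1)] adj by simp
  then show ?thesis unfolding gen_pauli_def using adj C(2) by blast
qed

section \<open>The Ising and XX interactions\<close>

text \<open>The span of the identity, X \<otimes> X, Y \<otimes> Y and Z \<otimes> Z. Each such
  matrix consists of one symmetric block on basis states 00, 11 and one on 01, 10, which makes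
  products and powers explicit.\<close>

definition xmat :: "complex \<Rightarrow> complex \<Rightarrow> complex \<Rightarrow> complex \<Rightarrow> complex mat" where
  "xmat p q r s = mat 4 4 (\<lambda>(i, j). [[p, 0, 0, q], [0, r, s, 0], [0, s, r, 0], [q, 0, 0, p]] ! i ! j)"

lemma xmat_carrier [simp]: "xmat p q r s \<in> carrier_mat 4 4"
  by (simp add: xmat_def)

lemma xmat_dim [simp]: "dim_row (xmat p q r s) = 4" "dim_col (xmat p q r s) = 4"
  by (simp_all add: xmat_def)

lemma xmat_mult:
  "xmat p q r s * xmat p' q' r' s' =
   xmat (p * p' + q * q') (p * q' + q * p') (r * r' + s * s') (r * s' + s * r')"
  by (rule eq_matI) (auto simp: less_4_iff mult_index_4 simp del: index_mult_mat(1), auto simp: xmat_def)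

lemma xmat_one: "1\<^sub>m 4 = xmat 1 0 1 0"
  by (rule eq_matI) (auto simp: less_4_iff xmat_def)

lemma xmat_adjoint: "mat_adjoint (xmat p q r s) = xmat (cnj p) (cnj q) (cnj r) (cnj s)"
  by (rule eq_matI) (auto simp: less_4_iff, auto simp: xmat_def)

text \<open>A block with zero diagonal and off-diagonal entry \<open>u\<close> has eigenvalues
  \<open>u\<close> and \<open>- u\<close>. Its even powers are diagonal and its odd powers
  off-diagonal.\<close>

lemma xmat_power:
  "xmat 0 u 0 v ^\<^sub>m k = xmat ((u ^ k + (- u) ^ k) / 2) ((u ^ k - (- u) ^ k) / 2)
     ((v ^ k + (- v) ^ k) / 2) ((v ^ k - (- v) ^ k) / 2)"
proof (induction k)
  case 0
  show ?case by (simp add: xmat_one)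
next
  case (Suc k)
  then show ?case by (simp add: xmat_mult field_simps)
qed

text \<open>Summing the powers entrywise gives hyperbolic cosines on the diagonals of the blocks and
  hyperbolic sines off them.\<close>

lemma mat_exp_xmat:
  "mat_exp (xmat 0 u 0 v) = xmat ((exp u + exp (- u)) / 2) ((exp u - exp (- u)) / 2)
     ((exp v + exp (- v)) / 2) ((exp v - exp (- v)) / 2)"
proof -
  have e: "(\<lambda>k. z ^ k / fact k) sums exp z" for z :: complex
    using exp_converges [of z] by (simp add: scaleR_conv_of_real divide_inverse mult.commute)
  have p: "(\<Sum>k. (z ^ k + (- z) ^ k) / (2 * fact k)) = (exp z + exp (- z)) / 2" for z :: complex
    using sums_divide [OF sums_add [OF e [of z] e [of "- z"]], of 2]
    by (intro sums_unique [symmetric]) (simp add: add_divide_distrib mult.commute)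
  have m: "(\<Sum>k. (z ^ k - (- z) ^ k) / (2 * fact k)) = (exp z - exp (- z)) / 2" for z :: complex
    using sums_divide [OF sums_diff [OF e [of z] e [of "- z"]], of 2]
    by (intro sums_unique [symmetric]) (simp add: diff_divide_distrib mult.commute)
  show ?thesis
    by (rule eq_matI)
      (auto simp: mat_exp_def xmat_power less_4_iff, auto simp: xmat_def p m)
qed

text \<open>X \<otimes> X and Y \<otimes> Y are opposite on the span of 00 and 11 and equal on the
  span of 01 and 10, whence the angles \<open>a - b\<close> and \<open>a + b\<close> in the two
  blocks.\<close>

lemma nonlocal_D_eq:
  "nonlocal_D a b 0 = xmat (of_real (cos (a - b))) (- \<i> * of_real (sin (a - b)))
     (of_real (cos (a + b))) (- \<i> * of_real (sin (a + b)))"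
proof -
  have "- \<i> \<cdot>\<^sub>m (complex_of_real a \<cdot>\<^sub>m (pauli_X \<otimes>\<^sub>k pauli_X)
      + complex_of_real b \<cdot>\<^sub>m (pauli_Y \<otimes>\<^sub>k pauli_Y) + complex_of_real 0 \<cdot>\<^sub>m (pauli_Z \<otimes>\<^sub>k pauli_Z)) =
      xmat 0 (- \<i> * of_real (a - b)) 0 (- \<i> * of_real (a + b))"
    by (rule eq_matI) (auto simp: less_4_iff pauli_mat2 kron_mat2_index xmat_def algebra_simps)
  then have "nonlocal_D a b 0 = mat_exp (xmat 0 (- \<i> * of_real (a - b)) 0 (- \<i> * of_real (a + b)))"
    unfolding nonlocal_D_def by (rule arg_cong)
  moreover have "(exp (- \<i> * of_real t) + exp (- (- \<i> * of_real t))) / 2 = of_real (cos t)"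
    "(exp (- \<i> * of_real t) - exp (- (- \<i> * of_real t))) / 2 = - \<i> * of_real (sin t)" for t
  proof -
    have "exp (- \<i> * of_real t) = cis (- t)" "exp (- (- \<i> * of_real t)) = cis t"
      by (simp_all add: cis_conv_exp)
    then show "(exp (- \<i> * of_real t) + exp (- (- \<i> * of_real t))) / 2 = of_real (cos t)"
      "(exp (- \<i> * of_real t) - exp (- (- \<i> * of_real t))) / 2 = - \<i> * of_real (sin t)"
      by (simp_all only:) (simp_all add: complex_eq_iff)
  qed
  ultimately show ?thesis by (simp only: mat_exp_xmat)
qed

lemma unitary_nonlocal_D: "unitary_op 4 (nonlocal_D a b 0)"
proof -
  have "complex_of_real (cos t) * of_real (cos t) + (- \<i> * of_real (sin t)) * (\<i> * of_real (sin t)) = 1"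
    "complex_of_real (cos t) * of_real (cos t) + (\<i> * of_real (sin t)) * (- \<i> * of_real (sin t)) = 1"
    "complex_of_real (cos t) * (\<i> * of_real (sin t)) + (- \<i> * of_real (sin t)) * of_real (cos t) = 0"
    "complex_of_real (cos t) * (- \<i> * of_real (sin t)) + (\<i> * of_real (sin t)) * of_real (cos t) = 0" for t
    using sin_cos_squared_add3 [of t] by (simp_all add: complex_eq_iff)
  moreover have "mat_adjoint (nonlocal_D a b 0) =
      xmat (of_real (cos (a - b))) (\<i> * of_real (sin (a - b))) (of_real (cos (a + b))) (\<i> * of_real (sin (a + b)))"
    by (simp add: nonlocal_D_eq xmat_adjoint)
  ultimately show ?thesis
    unfolding nonlocal_D_eq by (intro unitaryI) (simp_all only: xmat_mult xmat_one nonlocal_D_eq, simp)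
qed

section \<open>Images of Pauli matrices under the two model interactions\<close>

lemma transports_index_4I:
  assumes "D \<in> carrier_mat 4 4" "M \<in> carrier_mat 2 2" "T \<in> carrier_mat 4 4"
    and "\<And>i j. i < 4 \<Longrightarrow> j < 4 \<Longrightarrow>
      D $$ (i, 0) * (1\<^sub>m 2 \<otimes>\<^sub>k M) $$ (0, j) + D $$ (i, 1) * (1\<^sub>m 2 \<otimes>\<^sub>k M) $$ (1, j) +
      D $$ (i, 2) * (1\<^sub>m 2 \<otimes>\<^sub>k M) $$ (2, j) + D $$ (i, 3) * (1\<^sub>m 2 \<otimes>\<^sub>k M) $$ (3, j) =
      T $$ (i, 0) * D $$ (0, j) + T $$ (i, 1) * D $$ (1, j) +
      T $$ (i, 2) * D $$ (2, j) + T $$ (i, 3) * D $$ (3, j)"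
  shows "transports D M T"
proof -
  have c: "1\<^sub>m 2 \<otimes>\<^sub>k M \<in> carrier_mat 4 4" using assms by simp
  have "D * (1\<^sub>m 2 \<otimes>\<^sub>k M) = T * D"
  proof (rule eq_matI)
    fix i j assume "i < dim_row (T * D)" "j < dim_col (T * D)"
    then have ij: "i < 4" "j < 4" using assms by auto
    show "(D * (1\<^sub>m 2 \<otimes>\<^sub>k M)) $$ (i, j) = (T * D) $$ (i, j)"
      unfolding mult_index_4 [OF assms(1) c ij] mult_index_4 [OF assms(3,1) ij] using assms(4) ij .
  qed (use assms in auto)
  then show ?thesis using assms by (simp add: transports_def)
qed

text \<open>X \<otimes> X commutes with 1 \<otimes> X and anticommutes with 1 \<otimes> Z.
  Conjugating the latter therefore doubles the exponent to \<pi>/2, which multiplies it by -\<i> X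
  \<otimes> X, and XZ = -\<i> Y.\<close>

lemma ising_transports:
  "transports (nonlocal_D (pi / 4) 0 0) pauli_X (1\<^sub>m 2 \<otimes>\<^sub>k pauli_X)"
  "transports (nonlocal_D (pi / 4) 0 0) pauli_Z (pauli_X \<otimes>\<^sub>k (- pauli_Y))"
proof -
  define c where "c = complex_of_real (cos (pi / 4))"
  have D: "nonlocal_D (pi / 4) 0 0 = xmat c (- \<i> * c) c (- \<i> * c)"
    by (simp add: nonlocal_D_eq c_def sin_45 cos_45)
  show "transports (nonlocal_D (pi / 4) 0 0) pauli_X (1\<^sub>m 2 \<otimes>\<^sub>k pauli_X)"
    "transports (nonlocal_D (pi / 4) 0 0) pauli_Z (pauli_X \<otimes>\<^sub>k (- pauli_Y))"
    unfolding D pauli_mat2 one_mat2 mat2_uminus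
    by (intro transports_index_4I;
        auto simp: one_mat2 kron_mat2_index xmat_def less_4_iff)+
qed

lemma xx_transports:
  "transports (nonlocal_D (pi / 4) (pi / 4) 0) pauli_Z (pauli_Z \<otimes>\<^sub>k 1\<^sub>m 2)"
  "transports (nonlocal_D (pi / 4) (pi / 4) 0) pauli_X ((- pauli_Y) \<otimes>\<^sub>k pauli_Z)"
proof -
  \<comment> \<open>The angles are 0 and \<pi>/2: the states 00 and 11 are fixed, while 01 and 10
    are exchanged with factor -\<i>. This is a swap up to phases, which is why Z moves from the
    register to the ancilla.\<close>
  have D: "nonlocal_D (pi / 4) (pi / 4) 0 = xmat 1 0 0 (- \<i>)"
    by (simp add: nonlocal_D_eq)
  show "transports (nonlocal_D (pi / 4) (pi / 4) 0) pauli_Z (pauli_Z \<otimes>\<^sub>k 1\<^sub>m 2)"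
    "transports (nonlocal_D (pi / 4) (pi / 4) 0) pauli_X ((- pauli_Y) \<otimes>\<^sub>k pauli_Z)"
    unfolding D pauli_mat2 one_mat2 mat2_uminus
    by (intro transports_index_4I;
        auto simp: one_mat2 kron_mat2_index xmat_def less_4_iff)+
qed

section \<open>Recovering an interaction from the images of two generalized Paulis\<close>

lemma transports_compose:
  assumes "transports D M T" "D \<in> carrier_mat 4 4" "L \<in> carrier_mat 4 4" "T' \<in> carrier_mat 4 4"
    and "L * T = T' * L"
  shows "transports (L * D) M T'"
  using assms intertwine_trans [of "1\<^sub>m 2 \<otimes>\<^sub>k M" 4 T T' D L] by (auto simp: transports_def)

lemma kron_intertwine:
  assumes "unitary_op 2 W'" "unitary_op 2 W" "A \<in> carrier_mat 2 2" "A' \<in> carrier_mat 2 2"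
    "B \<in> carrier_mat 2 2" "B' \<in> carrier_mat 2 2" "W' * A = A' * W'" "W * B = B' * W"
  shows "(W' \<otimes>\<^sub>k W) * (A \<otimes>\<^sub>k B) = (A' \<otimes>\<^sub>k B') * (W' \<otimes>\<^sub>k W)"
  using assms by (simp add: kron_mult [of _ 2 2 _ 2 2 _ 2 _ 2])

text \<open>The anticommutator of \<open>B1\<close> and \<open>B2\<close> is a scalar
  \<open>b\<close>, and the hypothesis reduces to \<open>b\<close> times \<open>A\<close> being the
  scalar \<open>c\<close>. Since \<open>A\<close> is traceless and nonzero, \<open>c\<close> and
  then \<open>b\<close> vanish.\<close>

lemma anticommutes_of_scalar_kron:
  assumes P: "gen_pauli P" "gen_pauli Q" and A: "gen_pauli A" and B: "gen_pauli B1" "gen_pauli B2"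
    and e: "A \<otimes>\<^sub>k (B1 * B2 + B2 * B1) = c \<cdot>\<^sub>m 1\<^sub>m 4 \<or> (B1 * B2 + B2 * B1) \<otimes>\<^sub>k A = c \<cdot>\<^sub>m 1\<^sub>m 4"
    and c: "P * Q + Q * P = c \<cdot>\<^sub>m 1\<^sub>m 2"
  shows "P * Q = - (Q * P)" "B1 * B2 = - (B2 * B1)"
proof -
  obtain b where b: "B1 * B2 + B2 * B1 = b \<cdot>\<^sub>m 1\<^sub>m 2" using gen_pauli_anticommutator B by blast
  have bA: "b \<cdot>\<^sub>m A = c \<cdot>\<^sub>m 1\<^sub>m 2"
    using e unfolding b by (elim disjE) (rule kron_scalar kron_scalar'; use A in simp)+
  obtain a :: real and w where Am: "A = mat2 (of_real a) w (cnj w) (- of_real a)"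
    and n: "of_real a * of_real a + w * cnj w = 1"
    using A by (rule gen_pauli_cases)
  have "b * of_real a = c" "b * w = 0" "- (b * of_real a) = c"
    using bA unfolding Am one_mat2 by auto
  then have c0: "c = 0" and "b * of_real a = 0" "b * w = 0" by auto
  then have "b * (of_real a * of_real a + w * cnj w) = 0"
    by auto
  then have b0: "b = 0" using n by simp
  have anti: "X = - Y" if "X + Y = 0 \<cdot>\<^sub>m 1\<^sub>m 2" "X \<in> carrier_mat 2 2" "Y \<in> carrier_mat 2 2" for X Y :: "complex mat"
    using that by (elim mat2_cases) (auto simp: one_mat2 eq_neg_iff_add_eq_0)
  show "P * Q = - (Q * P)" "B1 * B2 = - (B2 * B1)"
    using b c P B by (auto intro!: anti simp: b0 c0)
qed

text \<open>Comparing the images of \<open>P * Q + Q * P\<close> shows that both pairs anticommute.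
  Local unitaries then match the pairs with those of the Ising interaction, and two interactions
  with equal images differ by an ancilla unitary.\<close>

lemma ising_from_transports:
  assumes E: "unitary_op 4 E" and P: "gen_pauli P" "gen_pauli Q"
    and A: "gen_pauli A" and B: "gen_pauli B1" "gen_pauli B2"
    and tP: "transports E P (1\<^sub>m 2 \<otimes>\<^sub>k B1)" and tQ: "transports E Q (A \<otimes>\<^sub>k B2)"
  shows "\<exists>W' W V' V. unitary_op 2 W' \<and> unitary_op 2 W \<and> unitary_op 2 V' \<and> unitary_op 2 V \<and>
    E = (W' \<otimes>\<^sub>k W) * nonlocal_D (pi / 4) 0 0 * (V' \<otimes>\<^sub>k V)"
proof -
  have c [simp]: "E \<in> carrier_mat 4 4" using E by simp
  obtain c where c: "P * Q + Q * P = c \<cdot>\<^sub>m 1\<^sub>m 2" using gen_pauli_anticommutator P by blast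
  have "transports E (P * Q + Q * P) ((1\<^sub>m 2 \<otimes>\<^sub>k B1) * (A \<otimes>\<^sub>k B2) + (A \<otimes>\<^sub>k B2) * (1\<^sub>m 2 \<otimes>\<^sub>k B1))"
    using tP tQ by (intro transports_add transports_mult) auto
  also have "(1\<^sub>m 2 \<otimes>\<^sub>k B1) * (A \<otimes>\<^sub>k B2) + (A \<otimes>\<^sub>k B2) * (1\<^sub>m 2 \<otimes>\<^sub>k B1) = A \<otimes>\<^sub>k (B1 * B2 + B2 * B1)"
    using A B by (simp add: kron_mult [of _ 2 2 _ 2 2 _ 2 _ 2] kron_add_right [of _ 2 2]
        left_mult_one_mat [of _ 2 2] right_mult_one_mat [of _ 2 2])
  finally have "A \<otimes>\<^sub>k (B1 * B2 + B2 * B1) = c \<cdot>\<^sub>m 1\<^sub>m 4"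
    unfolding c using transports_unique [OF E] transports_smult [OF _ transports_one] by auto
  then have ac: "P * Q = - (Q * P)" "B1 * B2 = - (B2 * B1)"
    using anticommutes_of_scalar_kron [OF P A B _ c] by auto
  have XY: "pauli_X * (- pauli_Y) = - (- pauli_Y * pauli_X)" and XZ: "pauli_X * pauli_Z = - (pauli_Z * pauli_X)"
    by (simp_all add: pauli_mat2)
  \<comment> \<open>\<open>V\<close> rotates the inputs \<open>P\<close>, \<open>Q\<close> to X, Z.
    Below, \<open>W\<close> and \<open>W'\<close> rotate the images X, -Y on the register and X on
    the ancilla to \<open>B1\<close>, \<open>B2\<close> and \<open>A\<close>.\<close>
  obtain V where V: "unitary_op 2 V" "V * P = pauli_X * V" "V * Q = pauli_Z * V"
    using gen_pauli_pair_conjugate [OF P ac(1) _ _ XZ] by auto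
  obtain W where W: "unitary_op 2 W" "W * pauli_X = B1 * W" "W * (- pauli_Y) = B2 * W"
    using gen_pauli_pair_conjugate [OF _ _ XY B ac(2)] by auto
  obtain W' where W': "unitary_op 2 W'" "W' * pauli_X = A * W'"
    using gen_pauli_conjugate [OF _ A] gen_pauli_XYZ by metis
  let ?D = "nonlocal_D (pi / 4) 0 0" and ?L = "W' \<otimes>\<^sub>k W"
  have u: "unitary_op 4 ?L" "unitary_op 4 (?L * ?D)"
    using W W' by (auto intro!: unitary_mult unitary_kron unitary_nonlocal_D)
  have "transports (?L * ?D) pauli_X (1\<^sub>m 2 \<otimes>\<^sub>k B1)"
    by (rule transports_compose [OF ising_transports(1)])
      (use u W W' A B unitary_nonlocal_D [of "pi / 4" 0] in \<open>auto intro!: kron_intertwine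
        simp: left_mult_one_mat [of _ 2 2] right_mult_one_mat [of _ 2 2]\<close>)
  moreover have "transports (?L * ?D) pauli_Z (A \<otimes>\<^sub>k B2)"
    by (rule transports_compose [OF ising_transports(2)])
      (use u W W' A B unitary_nonlocal_D [of "pi / 4" 0] in \<open>auto intro!: kron_intertwine
        simp: left_mult_one_mat [of _ 2 2] right_mult_one_mat [of _ 2 2]\<close>)
  ultimately obtain V' where "unitary_op 2 V'" "E = ?L * ?D * (V' \<otimes>\<^sub>k V)"
    using factor_from_transport [OF E u(2) V(1) tP _ V(2) tQ _ V(3)] by blast
  with V W W' show ?thesis by blast
qed

text \<open>The same argument with ancilla and register exchanged in the images: here the ancilla
  carries the anticommuting pair.\<close>

lemma xx_from_transports:
  assumes E: "unitary_op 4 E" and P: "gen_pauli P" "gen_pauli Q"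
    and A: "gen_pauli A1" "gen_pauli A2" and B: "gen_pauli B"
    and tP: "transports E P (A1 \<otimes>\<^sub>k 1\<^sub>m 2)" and tQ: "transports E Q (A2 \<otimes>\<^sub>k B)"
  shows "\<exists>W' W V' V. unitary_op 2 W' \<and> unitary_op 2 W \<and> unitary_op 2 V' \<and> unitary_op 2 V \<and>
    E = (W' \<otimes>\<^sub>k W) * nonlocal_D (pi / 4) (pi / 4) 0 * (V' \<otimes>\<^sub>k V)"
proof -
  have c [simp]: "E \<in> carrier_mat 4 4" using E by simp
  obtain c where c: "P * Q + Q * P = c \<cdot>\<^sub>m 1\<^sub>m 2" using gen_pauli_anticommutator P by blast
  have "transports E (P * Q + Q * P) ((A1 \<otimes>\<^sub>k 1\<^sub>m 2) * (A2 \<otimes>\<^sub>k B) + (A2 \<otimes>\<^sub>k B) * (A1 \<otimes>\<^sub>k 1\<^sub>m 2))"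
    using tP tQ by (intro transports_add transports_mult) auto
  also have "(A1 \<otimes>\<^sub>k 1\<^sub>m 2) * (A2 \<otimes>\<^sub>k B) + (A2 \<otimes>\<^sub>k B) * (A1 \<otimes>\<^sub>k 1\<^sub>m 2) = (A1 * A2 + A2 * A1) \<otimes>\<^sub>k B"
    using A B by (simp add: kron_mult [of _ 2 2 _ 2 2 _ 2 _ 2] kron_add_left [of _ 2 2]
        left_mult_one_mat [of _ 2 2] right_mult_one_mat [of _ 2 2])
  finally have "(A1 * A2 + A2 * A1) \<otimes>\<^sub>k B = c \<cdot>\<^sub>m 1\<^sub>m 4"
    unfolding c using transports_unique [OF E] transports_smult [OF _ transports_one] by auto
  then have ac: "P * Q = - (Q * P)" "A1 * A2 = - (A2 * A1)"
    using anticommutes_of_scalar_kron [OF P B A _ c] by auto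
  have ZY: "pauli_Z * (- pauli_Y) = - (- pauli_Y * pauli_Z)" and ZX: "pauli_Z * pauli_X = - (pauli_X * pauli_Z)"
    by (simp_all add: pauli_mat2)
  obtain V where V: "unitary_op 2 V" "V * P = pauli_Z * V" "V * Q = pauli_X * V"
    using gen_pauli_pair_conjugate [OF P ac(1) _ _ ZX] by auto
  obtain W' where W': "unitary_op 2 W'" "W' * pauli_Z = A1 * W'" "W' * (- pauli_Y) = A2 * W'"
    using gen_pauli_pair_conjugate [OF _ _ ZY A ac(2)] by auto
  obtain W where W: "unitary_op 2 W" "W * pauli_Z = B * W"
    using gen_pauli_conjugate [OF _ B] gen_pauli_XYZ by metis
  let ?D = "nonlocal_D (pi / 4) (pi / 4) 0" and ?L = "W' \<otimes>\<^sub>k W"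
  have u: "unitary_op 4 ?L" "unitary_op 4 (?L * ?D)"
    using W W' by (auto intro!: unitary_mult unitary_kron unitary_nonlocal_D)
  have Z: "transports (?L * ?D) pauli_Z (A1 \<otimes>\<^sub>k 1\<^sub>m 2)"
    by (rule transports_compose [OF xx_transports(1)])
      (use u W W' A B unitary_nonlocal_D [of "pi / 4" "pi / 4"] in \<open>auto intro!: kron_intertwine
        simp: left_mult_one_mat [of _ 2 2] right_mult_one_mat [of _ 2 2]\<close>)
  have X: "transports (?L * ?D) pauli_X (A2 \<otimes>\<^sub>k B)"
    by (rule transports_compose [OF xx_transports(2)])
      (use u W W' A B unitary_nonlocal_D [of "pi / 4" "pi / 4"] in \<open>auto intro!: kron_intertwine
        simp: left_mult_one_mat [of _ 2 2] right_mult_one_mat [of _ 2 2]\<close>)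
  obtain V' where "unitary_op 2 V'" "E = ?L * ?D * (V' \<otimes>\<^sub>k V)"
    using factor_from_transport [OF E u(2) V(1) tQ X V(3) tP Z V(2)] by blast
  with V W W' show ?thesis by blast
qed

text \<open>The target factorisation without a global phase, since the local unitaries can absorb
  one.\<close>

definition maximally_coupled :: "complex mat \<Rightarrow> bool" where
  "maximally_coupled E \<longleftrightarrow> (\<exists>W' W V' V D.
    unitary_op 2 W' \<and> unitary_op 2 W \<and> unitary_op 2 V' \<and> unitary_op 2 V \<and>
    (D = nonlocal_D (pi / 4) 0 0 \<or> D = nonlocal_D (pi / 4) (pi / 4) 0) \<and>
    E = (W' \<otimes>\<^sub>k W) * D * (V' \<otimes>\<^sub>k V))"

lemma mat_trace_commutator:
  "A \<in> carrier_mat 2 2 \<Longrightarrow> B \<in> carrier_mat 2 2 \<Longrightarrow> mat_trace (k \<cdot>\<^sub>m (A * B + (- 1) \<cdot>\<^sub>m (B * A))) = 0"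
  by (elim mat2_cases) (simp add: algebra_simps)

text \<open>The image of the scalar \<open>P * Q + Q * P\<close> is scalar, so by the dichotomy
  \<open>A1 * A2\<close> or \<open>B1 * B2\<close> is scalar, and that pair agrees up to sign. The
  normalised commutator of \<open>P\<close> and \<open>Q\<close> then has an image acting on one
  side only; paired with \<open>P\<close> it falls under the Ising or the XX case.\<close>

lemma maximally_coupled_of_both:
  assumes E: "unitary_op 4 E" and P: "gen_pauli P" "gen_pauli Q" "Q \<noteq> P" "Q \<noteq> - P"
    and A: "gen_pauli A1" "gen_pauli A2" and B: "gen_pauli B1" "gen_pauli B2"
    and tP: "transports E P (A1 \<otimes>\<^sub>k B1)" and tQ: "transports E Q (A2 \<otimes>\<^sub>k B2)"
  shows "maximally_coupled E"
proof -
  have cE: "E \<in> carrier_mat 4 4" using E by simp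
  have [simp]: "P \<in> carrier_mat 2 2" "Q \<in> carrier_mat 2 2" "A1 \<in> carrier_mat 2 2" "A2 \<in> carrier_mat 2 2"
    "B1 \<in> carrier_mat 2 2" "B2 \<in> carrier_mat 2 2"
    using P A B by auto
  have PQ: "transports E (P * Q) ((A1 * A2) \<otimes>\<^sub>k (B1 * B2))" and QP: "transports E (Q * P) ((A2 * A1) \<otimes>\<^sub>k (B2 * B1))"
    using transports_mult [OF cE tP tQ] transports_mult [OF cE tQ tP]
    by (simp_all add: kron_mult [of _ 2 2 _ 2 2 _ 2 _ 2])
  obtain a where a: "A1 * A2 + A2 * A1 = a \<cdot>\<^sub>m 1\<^sub>m 2" using gen_pauli_anticommutator A by blast
  obtain b where b: "B1 * B2 + B2 * B1 = b \<cdot>\<^sub>m 1\<^sub>m 2" using gen_pauli_anticommutator B by blast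
  obtain c where c: "P * Q + Q * P = c \<cdot>\<^sub>m 1\<^sub>m 2" using gen_pauli_anticommutator P by blast
  have tr: "mat_trace (X * Y) = k" if "X * Y + Y * X = k \<cdot>\<^sub>m 1\<^sub>m 2" "X \<in> carrier_mat 2 2" "Y \<in> carrier_mat 2 2"
    for X Y k
  proof -
    have "mat_trace (X * Y) + mat_trace (Y * X) = mat_trace (X * Y + Y * X)"
      using that(2,3) by (elim mat2_cases) simp
    then show ?thesis
      using mat_trace_cyclic [OF that(2,3)] unfolding that(1) by (simp add: one_mat2)
  qed
  have "transports E (P * Q + Q * P) ((A1 * A2) \<otimes>\<^sub>k (B1 * B2) + (A2 * A1) \<otimes>\<^sub>k (B2 * B1))"
    by (rule transports_add [OF cE PQ QP])
  then have "(A1 * A2) \<otimes>\<^sub>k (B1 * B2) + (A2 * A1) \<otimes>\<^sub>k (B2 * B1) = c \<cdot>\<^sub>m 1\<^sub>m 4"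
    using transports_unique [OF E _ transports_smult [OF cE transports_one [OF cE]]] unfolding c by blast
  then have dich: "A1 * A2 = (a / 2) \<cdot>\<^sub>m 1\<^sub>m 2 \<or> B1 * B2 = (b / 2) \<cdot>\<^sub>m 1\<^sub>m 2"
    using kron_scalar_dichotomy [of "A1 * A2" "A2 * A1" a "B1 * B2" "B2 * B1" b c] a b tr by simp
  have sgn: "Y = X \<or> Y = - X" if "gen_pauli X" "gen_pauli Y" "X * Y = k \<cdot>\<^sub>m 1\<^sub>m 2" for X Y k
  proof -
    have "Y = X * (X * Y)" using that unitary_cancel_left(1) [of 2 X Y 2] by simp
    also have "\<dots> = k \<cdot>\<^sub>m X"
      using that by (simp add: mult_smult_distrib [of _ 2 2 _ 2] right_mult_one_mat [of _ 2 2])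
    finally show ?thesis using gen_pauli_collinear(1) that by blast
  qed
  obtain \<gamma> where \<gamma>: "gen_pauli (\<gamma> \<cdot>\<^sub>m (P * Q - Q * P))"
    using gen_pauli_commutator P by blast
  \<comment> \<open>Differences become sums so that the closure of \<open>transports\<close> under
    addition and scaling applies to the commutator.\<close>
  have diff: "X - Y = X + (- 1) \<cdot>\<^sub>m Y" if "X \<in> carrier_mat 2 2" "Y \<in> carrier_mat 2 2" for X Y :: "complex mat"
    using that by (intro eq_matI) auto
  let ?N = "\<gamma> \<cdot>\<^sub>m (P * Q + (- 1) \<cdot>\<^sub>m (Q * P))"
  have N: "gen_pauli ?N" using \<gamma> diff [of "P * Q" "Q * P"] by simp
  have tN: "transports E ?N (\<gamma> \<cdot>\<^sub>m ((A1 * A2) \<otimes>\<^sub>k (B1 * B2) + (- 1) \<cdot>\<^sub>m ((A2 * A1) \<otimes>\<^sub>k (B2 * B1))))"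
    by (intro transports_smult transports_add cE PQ QP)
  from dich show ?thesis
  proof
    assume "A1 * A2 = (a / 2) \<cdot>\<^sub>m 1\<^sub>m 2"
    then have A12: "A2 = A1 \<or> A2 = - A1" using sgn A by blast
    \<comment> \<open>Since \<open>A2\<close> is \<open>A1\<close> up to sign, both orders of the
      product give the same sign \<open>k\<close>, which leaves only the commutator of
      \<open>B1\<close> and \<open>B2\<close> on the register.\<close>
    obtain k :: complex where k: "A1 * A2 = k \<cdot>\<^sub>m 1\<^sub>m 2" "A2 * A1 = k \<cdot>\<^sub>m 1\<^sub>m 2"
    proof -
      have "A1 * A2 = (if A2 = A1 then 1 else - 1) \<cdot>\<^sub>m 1\<^sub>m 2" "A2 * A1 = (if A2 = A1 then 1 else - 1) \<cdot>\<^sub>m 1\<^sub>m 2"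
        using A A12 by (auto simp: one_mat2)
      then show ?thesis using that by blast
    qed
    let ?C = "(\<gamma> * k) \<cdot>\<^sub>m (B1 * B2 + (- 1) \<cdot>\<^sub>m (B2 * B1))"
    have "\<gamma> \<cdot>\<^sub>m ((A1 * A2) \<otimes>\<^sub>k (B1 * B2) + (- 1) \<cdot>\<^sub>m ((A2 * A1) \<otimes>\<^sub>k (B2 * B1))) = 1\<^sub>m 2 \<otimes>\<^sub>k ?C"
      unfolding k by (rule kron_scalar_combination(1)) auto
    with tN have t: "transports E ?N (1\<^sub>m 2 \<otimes>\<^sub>k ?C)" by simp
    have "gen_pauli ?C"
      by (rule gen_pauli_of_transports [OF E N _ _ disjI1 [OF refl] t]) (simp_all add: mat_trace_commutator)
    then show ?thesis
      using ising_from_transports [OF E N P(1) A(1) _ B(1) t tP] unfolding maximally_coupled_def by blast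
  next
    assume "B1 * B2 = (b / 2) \<cdot>\<^sub>m 1\<^sub>m 2"
    then have B12: "B2 = B1 \<or> B2 = - B1" using sgn B by blast
    obtain k :: complex where k: "B1 * B2 = k \<cdot>\<^sub>m 1\<^sub>m 2" "B2 * B1 = k \<cdot>\<^sub>m 1\<^sub>m 2"
    proof -
      have "B1 * B2 = (if B2 = B1 then 1 else - 1) \<cdot>\<^sub>m 1\<^sub>m 2" "B2 * B1 = (if B2 = B1 then 1 else - 1) \<cdot>\<^sub>m 1\<^sub>m 2"
        using B B12 by (auto simp: one_mat2)
      then show ?thesis using that by blast
    qed
    let ?C = "(\<gamma> * k) \<cdot>\<^sub>m (A1 * A2 + (- 1) \<cdot>\<^sub>m (A2 * A1))"
    have "\<gamma> \<cdot>\<^sub>m ((A1 * A2) \<otimes>\<^sub>k (B1 * B2) + (- 1) \<cdot>\<^sub>m ((A2 * A1) \<otimes>\<^sub>k (B2 * B1))) = ?C \<otimes>\<^sub>k 1\<^sub>m 2"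
      unfolding k by (rule kron_scalar_combination(2)) auto
    with tN have t: "transports E ?N (?C \<otimes>\<^sub>k 1\<^sub>m 2)" by simp
    have "gen_pauli ?C"
      by (rule gen_pauli_of_transports [OF E N _ _ disjI2 [OF refl] t]) (simp_all add: mat_trace_commutator)
    then show ?thesis
      using xx_from_transports [OF E N P(1) _ A(1) B(1) t tP] unfolding maximally_coupled_def by blast
  qed
qed

section \<open>Kraus operators and single-qubit steps\<close>

lemma ket_carrier: "v \<in> carrier_vec n \<Longrightarrow> ket v \<in> carrier_mat n 1"
  by (auto simp: ket_def)

lemma bra_carrier: "v \<in> carrier_vec n \<Longrightarrow> bra v \<in> carrier_mat 1 n"
  unfolding bra_def by (rule mat_adjoint_carrier [OF ket_carrier])

lemma ket_index: "i < dim_vec v \<Longrightarrow> ket v $$ (i, 0) = v $ i"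
  by (simp add: ket_def mat_of_cols_def)

lemma bra_index: "i < dim_vec v \<Longrightarrow> bra v $$ (0, i) = cnj (v $ i)"
  unfolding bra_def by (subst mat_adjoint_index) (auto simp: ket_index, auto simp: ket_def)

lemma couple_single: "E \<in> carrier_mat 4 4 \<Longrightarrow> couple 1 E 0 = E"
  by (rule eq_matI)
    (auto simp: couple_def split_block_def Let_def on_qubit_def less_4_iff,
      simp_all add: numeral_2_eq_2 numeral_3_eq_3)

text \<open>The coefficients are the products of the row with the two basis vectors. That they
  reproduce the row is the completeness relation of the basis.\<close>

lemma row_in_basis:
  assumes b: "orthonormal_basis (bp, bm)" and M: "M \<in> carrier_mat 1 2"
  obtains x y where "M = x \<cdot>\<^sub>m bra bp + y \<cdot>\<^sub>m bra bm"
proof -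
  have c: "bp \<in> carrier_vec 2" "bm \<in> carrier_vec 2"
    using b by (auto simp: orthonormal_basis_def unit_state_def)
  define p q r s where "p = bp $ 0" "q = bp $ 1" "r = bm $ 0" "s = bm $ 1"
  have sp: "v \<bullet>c w = v $ 0 * cnj (w $ 0) + v $ 1 * cnj (w $ 1)" if "w \<in> carrier_vec 2" for v w :: "complex vec"
    using that by (simp add: scalar_prod_def numeral_2_eq_2)
  have o: "p * cnj p + q * cnj q = 1" "r * cnj r + s * cnj s = 1" "p * cnj r + q * cnj s = 0"
    using b c by (auto simp: orthonormal_basis_def unit_state_def sp p_q_r_s_def)
  have o': "r * cnj p + s * cnj q = 0"
    using arg_cong [OF o(3), of cnj] by (simp add: mult.commute)
  \<comment> \<open>Orthonormality makes one matrix a left inverse of the other. For square matrices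
    it is also a right inverse, and this is completeness.\<close>
  have "mat2 (cnj p) (cnj q) (cnj r) (cnj s) * mat2 p r q s = 1\<^sub>m 2"
    using o o' by (simp add: one_mat2 mult.commute)
  then have "mat2 p r q s * mat2 (cnj p) (cnj q) (cnj r) (cnj s) = 1\<^sub>m 2"
    by (rule mat_mult_left_right_inverse [rotated 2]) auto
  then have i: "p * cnj p + r * cnj r = 1" "p * cnj q + r * cnj s = 0"
    "q * cnj p + s * cnj r = 0" "q * cnj q + s * cnj s = 1"
    by (simp_all add: one_mat2)
  define m n where "m = M $$ (0, 0)" "n = M $$ (0, 1)"
  have e: "(m * p + n * q) * cnj p + (m * r + n * s) * cnj r = m"
    "(m * p + n * q) * cnj q + (m * r + n * s) * cnj s = n"
  proof -
    have "(m * p + n * q) * cnj p + (m * r + n * s) * cnj r =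
        m * (p * cnj p + r * cnj r) + n * (q * cnj p + s * cnj r)" by (simp add: algebra_simps)
    then show "(m * p + n * q) * cnj p + (m * r + n * s) * cnj r = m" by (simp add: i)
    have "(m * p + n * q) * cnj q + (m * r + n * s) * cnj s =
        m * (p * cnj q + r * cnj s) + n * (q * cnj q + s * cnj s)" by (simp add: algebra_simps)
    then show "(m * p + n * q) * cnj q + (m * r + n * s) * cnj s = n" by (simp add: i)
  qed
  have "M = (m * p + n * q) \<cdot>\<^sub>m bra bp + (m * r + n * s) \<cdot>\<^sub>m bra bm"
  proof (rule eq_matI)
    fix i j
    assume "i < dim_row ((m * p + n * q) \<cdot>\<^sub>m bra bp + (m * r + n * s) \<cdot>\<^sub>m bra bm)"
      "j < dim_col ((m * p + n * q) \<cdot>\<^sub>m bra bp + (m * r + n * s) \<cdot>\<^sub>m bra bm)"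
    then have "i = 0" "j = 0 \<or> j = 1"
      using carrier_matD [OF bra_carrier [OF c(1)]] carrier_matD [OF bra_carrier [OF c(2)]] by auto
    then show "M $$ (i, j) = ((m * p + n * q) \<cdot>\<^sub>m bra bp + (m * r + n * s) \<cdot>\<^sub>m bra bm) $$ (i, j)"
      using c carrier_matD [OF bra_carrier [OF c(1)]] carrier_matD [OF bra_carrier [OF c(2)]] e
      by (auto simp: bra_index m_n_def p_q_r_s_def)
  qed (use M c carrier_matD [OF bra_carrier [OF c(2)]] in auto)
  then show ?thesis by (rule that)
qed

text \<open>\<open>Q\<close> passes the preparation of the ancilla, turns into
  \<open>A \<otimes> B\<close> on its way through \<open>E\<close>, and then \<open>B\<close> leaves
  to the left while \<open>A\<close> is absorbed by the bra.\<close>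

lemma kraus_transport:
  assumes a: "a \<in> carrier_vec 2" and b: "b \<in> carrier_vec 2" and E: "E \<in> carrier_mat 4 4"
    and A: "A \<in> carrier_mat 2 2" and B: "B \<in> carrier_mat 2 2" and t: "transports E Q (A \<otimes>\<^sub>k B)"
  shows "(bra b \<otimes>\<^sub>k 1\<^sub>m 2) * E * (ket a \<otimes>\<^sub>k 1\<^sub>m 2) * Q =
    B * (((bra b * A) \<otimes>\<^sub>k 1\<^sub>m 2) * E * (ket a \<otimes>\<^sub>k 1\<^sub>m 2))"
proof -
  let ?b = "bra b \<otimes>\<^sub>k 1\<^sub>m 2" and ?k = "ket a \<otimes>\<^sub>k 1\<^sub>m 2" and ?bA = "(bra b * A) \<otimes>\<^sub>k 1\<^sub>m 2"
  have Q: "Q \<in> carrier_mat 2 2" and e: "E * (1\<^sub>m 2 \<otimes>\<^sub>k Q) = (A \<otimes>\<^sub>k B) * E"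
    using t by (auto simp: transports_def)
  have k: "ket a \<in> carrier_mat 2 1" and br: "bra b \<in> carrier_mat 1 2" using ket_carrier [OF a] bra_carrier [OF b] .
  have brA: "bra b * A \<in> carrier_mat 1 2" using br A by (rule mult_carrier_mat)
  have c: "?b \<in> carrier_mat 2 4" "?k \<in> carrier_mat 4 2" "?bA \<in> carrier_mat 2 4"
    "1\<^sub>m 2 \<otimes>\<^sub>k Q \<in> carrier_mat 4 4" "A \<otimes>\<^sub>k B \<in> carrier_mat 4 4"
    using kron_carrier [OF br one_carrier_mat [of 2]] kron_carrier [OF k one_carrier_mat [of 2]]
      kron_carrier [OF brA one_carrier_mat [of 2]] Q A B by auto
  have "?k * (1\<^sub>m 1 \<otimes>\<^sub>k Q) = (1\<^sub>m 2 \<otimes>\<^sub>k Q) * ?k"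
    using k Q by (simp only: kron_mult [OF k one_carrier_mat one_carrier_mat Q]
        kron_mult [OF one_carrier_mat Q k one_carrier_mat] right_mult_one_mat left_mult_one_mat)
  then have kQ: "?k * Q = (1\<^sub>m 2 \<otimes>\<^sub>k Q) * ?k" by simp
  have "?b * (A \<otimes>\<^sub>k B) = (1\<^sub>m 1 \<otimes>\<^sub>k B) * ?bA"
    by (simp only: kron_mult [OF br one_carrier_mat A B] kron_mult [OF one_carrier_mat B brA one_carrier_mat]
        right_mult_one_mat [OF B] left_mult_one_mat [OF B] left_mult_one_mat [OF brA])
  then have bB: "?b * (A \<otimes>\<^sub>k B) = B * ?bA" by simp
  have cE: "?b * E \<in> carrier_mat 2 4" using c(1) E by (rule mult_carrier_mat)
  have "?b * E * ?k * Q = ?b * E * (?k * Q)"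
    by (rule assoc_mult_mat [OF cE c(2) Q])
  also have "\<dots> = ?b * E * (1\<^sub>m 2 \<otimes>\<^sub>k Q) * ?k"
    unfolding kQ by (rule assoc_mult_mat [OF cE c(4,2), symmetric])
  also have "?b * E * (1\<^sub>m 2 \<otimes>\<^sub>k Q) = ?b * (A \<otimes>\<^sub>k B) * E"
    unfolding assoc_mult_mat [OF c(1) E c(4)] e by (rule assoc_mult_mat [OF c(1,5) E, symmetric])
  also have "\<dots> = B * (?bA * E)"
    unfolding bB by (rule assoc_mult_mat [OF B c(3) E])
  also have "\<dots> * ?k = B * (?bA * E * ?k)"
    by (rule assoc_mult_mat [OF B mult_carrier_mat [OF c(3) E] c(2)])
  finally show ?thesis .
qed

text \<open>The two Kraus operators are nonzero multiples of \<open>U\<close> and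
  \<open>P * U\<close>. A correction passing the step changes the first bra into a combination of
  both, whence the factor in 1 and \<open>P\<close>. With a trivial ancilla factor nothing mixes,
  and each outcome yields its own identity.\<close>

lemma single_step_action:
  assumes E: "unitary_op 4 E" and S: "valid_scheme S" "stepwise_deterministic E S"
    and t: "t \<in> single_settings S"
  obtains U P where "unitary_op 2 U" "gen_pauli P" "P \<in> correction_factors E S"
    and "\<And>V. induces_unitary 1 E (Single t 0) Plus V \<Longrightarrow> \<exists>k. V = k \<cdot>\<^sub>m U"
    and "\<And>Q A B. A \<in> carrier_mat 2 2 \<Longrightarrow> B \<in> carrier_mat 2 2 \<Longrightarrow> transports E Q (A \<otimes>\<^sub>k B) \<Longrightarrow>
      \<exists>x y. U * Q = B * ((x \<cdot>\<^sub>m 1\<^sub>m 2 + y \<cdot>\<^sub>m P) * U)"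
    and "\<And>Q B. B \<in> carrier_mat 2 2 \<Longrightarrow> transports E Q (1\<^sub>m 2 \<otimes>\<^sub>k B) \<Longrightarrow>
      U * Q = B * U \<and> P * U * Q = B * (P * U)"
proof -
  obtain a bp bm where t_eq: "t = (a, (bp, bm))" by (metis prod.collapse)
  have b: "orthonormal_basis (bp, bm)" and a: "a \<in> carrier_vec 2"
    using bspec [OF S(1) [unfolded valid_scheme_def] UnI1 [OF t]] by (simp_all add: t_eq unit_state_def)
  have c: "bp \<in> carrier_vec 2" "bm \<in> carrier_vec 2"
    using b by (auto simp: orthonormal_basis_def unit_state_def)
  have cE [simp]: "E \<in> carrier_mat 4 4" using E by simp
  have step: "Single t 0 \<in> steps 1 S" using t unfolding steps_def by blast
  then obtain P where P: "single_correction 1 E t 0 P"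
    using S(2) [unfolded stepwise_deterministic_def, rule_format, of 1] by blast
  then have gP: "gen_pauli P" and rel: "related_by 1 E (Single t 0) P"
    by (auto simp: single_correction_def on_qubit_def)
  have Pcf: "P \<in> correction_factors E S"
    using P step unfolding correction_factors_def by blast
  define K where "K b = (bra b \<otimes>\<^sub>k 1\<^sub>m 2) * E * (ket a \<otimes>\<^sub>k 1\<^sub>m 2)" for b
  have K: "kraus 1 E (Single t 0) Plus = K bp" "kraus 1 E (Single t 0) Minus = K bm"
    by (simp_all add: kraus_def t_eq K_def ancilla_element_def couple_single [unfolded One_nat_def])
  obtain U Um \<Delta> where U: "induces_unitary 1 E (Single t 0) Plus U"
    and Um: "induces_unitary 1 E (Single t 0) Minus Um" "Um = cis \<Delta> \<cdot>\<^sub>m (P * U)"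
    using rel by (auto simp: related_by_def)
  have uU: "unitary_op 2 U" using U by (simp add: induces_unitary_def)
  obtain p where p: "p > 0" "K bp = complex_of_real (sqrt p) \<cdot>\<^sub>m U"
    using U K by (auto simp: induces_unitary_def)
  obtain m where m: "m > 0" "K bm = complex_of_real (sqrt m) \<cdot>\<^sub>m Um"
    using Um K by (auto simp: induces_unitary_def)
  \<comment> \<open>These scalars collect the square roots of the probabilities and the phase of the
    correction.\<close>
  define u v where "u = complex_of_real (sqrt p)" "v = complex_of_real (sqrt m) * cis \<Delta>"
  have uv: "u \<noteq> 0" "v \<noteq> 0" using p m by (auto simp: u_v_def)
  have Kp: "K bp = u \<cdot>\<^sub>m U" and Km: "K bm = v \<cdot>\<^sub>m (P * U)"
    using p m Um by (auto simp: u_v_def smult_smult_mat)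
  have [simp]: "U \<in> carrier_mat 2 2" "P \<in> carrier_mat 2 2" using uU gP by auto
  have inv: "X = Y" if "k \<cdot>\<^sub>m X = k \<cdot>\<^sub>m Y" "k \<noteq> 0" "X \<in> carrier_mat 2 2" "Y \<in> carrier_mat 2 2"
    for k and X Y :: "complex mat"
    using that by (elim mat2_cases) auto
  show ?thesis
  proof (rule that [OF uU gP Pcf])
    fix V assume "induces_unitary 1 E (Single t 0) Plus V"
    then obtain r where r: "r > 0" "u \<cdot>\<^sub>m U = complex_of_real (sqrt r) \<cdot>\<^sub>m V" and "V \<in> carrier_mat 2 2"
      using K Kp by (auto simp: induces_unitary_def)
    moreover have "complex_of_real (sqrt r) \<cdot>\<^sub>m V =
        complex_of_real (sqrt r) \<cdot>\<^sub>m ((u / complex_of_real (sqrt r)) \<cdot>\<^sub>m U)"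
      using r by (simp add: smult_smult_mat)
    ultimately have "V = (u / complex_of_real (sqrt r)) \<cdot>\<^sub>m U"
      using inv [of "complex_of_real (sqrt r)" V "(u / complex_of_real (sqrt r)) \<cdot>\<^sub>m U"] by simp
    then show "\<exists>k. V = k \<cdot>\<^sub>m U" by blast
  next
    fix Q A B
    assume A: "A \<in> carrier_mat 2 2" and B: "B \<in> carrier_mat 2 2" and tr: "transports E Q (A \<otimes>\<^sub>k B)"
    have Q: "Q \<in> carrier_mat 2 2" using tr by (simp add: transports_def)
    have "bra bp * A \<in> carrier_mat 1 2" using mult_carrier_mat [OF bra_carrier [OF c(1)] A] .
    then obtain x y where xy: "bra bp * A = x \<cdot>\<^sub>m bra bp + y \<cdot>\<^sub>m bra bm"
      using row_in_basis b by blast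
    let ?k = "ket a \<otimes>\<^sub>k 1\<^sub>m 2 :: complex mat"
    have k: "?k \<in> carrier_mat 4 2"
      using kron_carrier [OF ket_carrier [OF a] one_carrier_mat [of 2]] by simp
    have br: "bra b \<otimes>\<^sub>k 1\<^sub>m 2 \<in> carrier_mat 2 4" if "b \<in> carrier_vec 2" for b
      using kron_carrier [OF bra_carrier [OF that] one_carrier_mat [of 2]] by simp
    have brE: "(bra b \<otimes>\<^sub>k 1\<^sub>m 2) * E \<in> carrier_mat 2 4" if "b \<in> carrier_vec 2" for b
      using br [OF that] cE by (rule mult_carrier_mat)
    have "((bra bp * A) \<otimes>\<^sub>k 1\<^sub>m 2) * E * ?k = x \<cdot>\<^sub>m K bp + y \<cdot>\<^sub>m K bm"
      using c k br brE bra_carrier [OF c(1)] bra_carrier [OF c(2)] unfolding xy K_def One_nat_def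
      by (subst kron_add_left [of _ 1 2])
        (simp_all add: kron_smult_left add_mult_distrib_mat [of _ 2 4 _ _ 4] add_mult_distrib_mat [of _ 2 4 _ _ 2]
          mult_smult_assoc_mat [of _ 2 4 _ 4] mult_smult_assoc_mat [of _ 2 4 _ 2])
    then have "K bp * Q = B * (x \<cdot>\<^sub>m K bp + y \<cdot>\<^sub>m K bm)"
      using kraus_transport [OF a c(1) cE A B tr] by (simp add: K_def)
    \<comment> \<open>Factoring out the weight \<open>u\<close> of the first outcome rescales the
      coefficient of \<open>P\<close> to \<open>y * v / u\<close>.\<close>
    also have "x \<cdot>\<^sub>m K bp + y \<cdot>\<^sub>m K bm = u \<cdot>\<^sub>m ((x \<cdot>\<^sub>m 1\<^sub>m 2 + (y * v / u) \<cdot>\<^sub>m P) * U)"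
      using uv by (simp add: Kp Km add_mult_distrib_mat [of _ 2 2 _ _ 2] mult_smult_assoc_mat [of _ 2 2 _ 2]
          left_mult_one_mat [of _ 2 2] smult_smult_mat add_smult_distrib_left_mat [of _ 2 2] mult.commute)
    finally have "u \<cdot>\<^sub>m (U * Q) = u \<cdot>\<^sub>m (B * ((x \<cdot>\<^sub>m 1\<^sub>m 2 + (y * v / u) \<cdot>\<^sub>m P) * U))"
      using Q B by (simp add: Kp mult_smult_assoc_mat [of _ 2 2 _ 2] mult_smult_distrib [of _ 2 2 _ 2])
    then have "U * Q = B * ((x \<cdot>\<^sub>m 1\<^sub>m 2 + (y * v / u) \<cdot>\<^sub>m P) * U)"
      using uv Q B inv [of u "U * Q" "B * ((x \<cdot>\<^sub>m 1\<^sub>m 2 + (y * v / u) \<cdot>\<^sub>m P) * U)"] by simp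
    then show "\<exists>x y. U * Q = B * ((x \<cdot>\<^sub>m 1\<^sub>m 2 + y \<cdot>\<^sub>m P) * U)" by blast
  next
    fix Q B
    assume B: "B \<in> carrier_mat 2 2" and tr: "transports E Q (1\<^sub>m 2 \<otimes>\<^sub>k B)"
    have Q: "Q \<in> carrier_mat 2 2" using tr by (simp add: transports_def)
    have "K b * Q = B * K b" if "b \<in> carrier_vec 2" for b
      using kraus_transport [OF a that cE one_carrier_mat B tr]
      by (simp add: K_def right_mult_one_mat [OF bra_carrier [OF that]])
    from this [OF c(1)] this [OF c(2)]
    have "u \<cdot>\<^sub>m (U * Q) = u \<cdot>\<^sub>m (B * U)" "v \<cdot>\<^sub>m (P * U * Q) = v \<cdot>\<^sub>m (B * (P * U))"
      using Q B by (simp_all add: Kp Km mult_smult_assoc_mat [of _ 2 2 _ 2] mult_smult_distrib [of _ 2 2 _ 2])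
    then show "U * Q = B * U \<and> P * U * Q = B * (P * U)"
      using uv Q B inv [of u "U * Q" "B * U"] inv [of v "P * U * Q" "B * (P * U)"] by simp
  qed
qed

section \<open>Universality needs two non-commuting corrections\<close>

text \<open>\<open>U\<close> conjugates \<open>P\<close> to a multiple of itself, written without
  inverses so that the property passes to products and to scalar multiples.\<close>

definition scales :: "complex mat \<Rightarrow> complex mat \<Rightarrow> bool" where
  "scales P U \<longleftrightarrow> U \<in> carrier_mat 2 2 \<and> (\<exists>\<beta>. U * P = \<beta> \<cdot>\<^sub>m (P * U))"

lemma scales_one: "P \<in> carrier_mat 2 2 \<Longrightarrow> scales P (1\<^sub>m 2)"
  by (auto simp: scales_def intro!: exI [of _ 1] elim!: mat2_cases simp: one_mat2)

lemma scales_mult: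
  assumes P: "P \<in> carrier_mat 2 2" and "scales P U" "scales P V"
  shows "scales P (U * V)"
proof -
  obtain \<beta> \<gamma> where [simp]: "U \<in> carrier_mat 2 2" "V \<in> carrier_mat 2 2"
    and u: "U * P = \<beta> \<cdot>\<^sub>m (P * U)" and v: "V * P = \<gamma> \<cdot>\<^sub>m (P * V)"
    using assms by (auto simp: scales_def)
  have "U * V * P = U * (\<gamma> \<cdot>\<^sub>m (P * V))" using P by (simp add: assoc_mult_mat [of _ 2 2 _ 2 _ 2] v)
  also have "\<dots> = \<gamma> \<cdot>\<^sub>m (U * P * V)"
    using P by (simp add: mult_smult_distrib [of _ 2 2 _ 2] assoc_mult_mat [of _ 2 2 _ 2 _ 2])
  also have "\<dots> = (\<gamma> * \<beta>) \<cdot>\<^sub>m (P * (U * V))"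
    using P by (simp add: u mult_smult_assoc_mat [of _ 2 2 _ 2] smult_smult_mat assoc_mult_mat [of _ 2 2 _ 2 _ 2])
  finally show ?thesis by (auto simp: scales_def)
qed

lemma scales_smult:
  assumes "P \<in> carrier_mat 2 2" "scales P U"
  shows "scales P (k \<cdot>\<^sub>m U)"
proof -
  obtain \<beta> where [simp]: "U \<in> carrier_mat 2 2" and u: "U * P = \<beta> \<cdot>\<^sub>m (P * U)"
    using assms by (auto simp: scales_def)
  have "(k \<cdot>\<^sub>m U) * P = \<beta> \<cdot>\<^sub>m (P * (k \<cdot>\<^sub>m U))"
    using assms by (simp add: mult_smult_assoc_mat [of _ 2 2 _ 2] mult_smult_distrib [of _ 2 2 _ 2] u
        smult_smult_mat mult.commute)
  then show ?thesis by (auto simp: scales_def)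
qed

lemma scales_ordered_prod:
  assumes P: "P \<in> carrier_mat 2 2" and "\<forall>U \<in> set Us. scales P U"
  shows "scales P (ordered_prod 1 Us)"
proof -
  have "scales P (foldl (\<lambda>V U. U * V) V Us)" if "scales P V" for V
    using assms(2) that by (induction Us arbitrary: V) (auto simp: scales_mult [OF P])
  then show ?thesis using scales_one [OF P] by (simp add: ordered_prod_def)
qed

text \<open>Some unitary conjugates \<open>P\<close> to any given generalized Pauli. If all
  unitaries scaled \<open>P\<close>, both \<open>pauli_X\<close> and \<open>pauli_Z\<close> would be
  multiples of it.\<close>

lemma exists_non_scaling:
  assumes P: "gen_pauli P"
  shows "\<exists>U. unitary_op 2 U \<and> \<not> scales P U"
proof (rule ccontr)
  assume none: "\<not> (\<exists>U. unitary_op 2 U \<and> \<not> scales P U)"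
  have all: "scales P U" if "unitary_op 2 U" for U using that none by blast
  have collinear: "\<exists>\<beta>. Q = \<beta> \<cdot>\<^sub>m P" if Q: "gen_pauli Q" for Q
  proof -
    obtain U where U: "unitary_op 2 U" "U * P = Q * U" using gen_pauli_conjugate P Q by blast
    obtain \<beta> where "Q * U = \<beta> \<cdot>\<^sub>m (P * U)" using all [OF U(1)] U(2) by (auto simp: scales_def)
    then have "Q * U = (\<beta> \<cdot>\<^sub>m P) * U" using P U by (simp add: mult_smult_assoc_mat [of _ 2 2 _ 2])
    then have "Q * U * mat_adjoint U = (\<beta> \<cdot>\<^sub>m P) * U * mat_adjoint U" by simp
    then have "Q = \<beta> \<cdot>\<^sub>m P"
      using unitary_cancel_right(1) [OF U(1), of _ 2] P Q by simp
    then show ?thesis by blast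
  qed
  obtain x where x: "pauli_X = x \<cdot>\<^sub>m P" using collinear [of pauli_X] by auto
  obtain z where z: "pauli_Z = z \<cdot>\<^sub>m P" using collinear [of pauli_Z] by auto
  obtain p q r s where "P = mat2 p q r s" using P gen_pauli_carrier mat2_cases by blast
  then show False using x z by (auto simp: pauli_mat2)
qed

text \<open>On a one-qubit register every realised unitary is a product of single-step unitaries up
  to phase, and scaling \<open>P\<close> is inherited by such products.\<close>

lemma not_universal_if_scaling:
  assumes P: "gen_pauli P"
    and sc: "\<And>t V. t \<in> single_settings S \<Longrightarrow> induces_unitary 1 E (Single t 0) Plus V \<Longrightarrow> scales P V"
  shows "\<not> universal E S"
proof
  assume u: "universal E S"
  obtain U where U: "unitary_op 2 U" "\<not> scales P U" using exists_non_scaling P by blast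
  obtain ss Us \<phi> where ss: "set ss \<subseteq> steps 1 S"
    and l: "list_all2 (\<lambda>s V. induces_unitary 1 E s Plus V) ss Us"
    and e: "U = cis \<phi> \<cdot>\<^sub>m ordered_prod 1 Us"
    using u [unfolded universal_def, rule_format, of 1 U] U by auto
  have "\<forall>V \<in> set Us. scales P V"
  proof
    fix V assume "V \<in> set Us"
    then obtain i where i: "i < length ss" "V = Us ! i"
      using l by (auto simp: in_set_conv_nth list_all2_lengthD)
    then have "ss ! i \<in> steps 1 S" using ss nth_mem by blast
    \<comment> \<open>A two-qubit step addresses two distinct register qubits, so none occurs
      here.\<close>
    then obtain t where "ss ! i = Single t 0" "t \<in> single_settings S" by (auto simp: steps_def)
    then show "scales P V" using sc l i by (metis list_all2_nthD)
  qed
  then have "scales P U" unfolding e using P by (intro scales_smult scales_ordered_prod) auto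
  with U show False by blast
qed

text \<open>The conjugate of \<open>P\<close> by \<open>U\<close> has trace zero, while the
  combination has trace \<open>2 * x\<close>. Hence \<open>x = 0\<close>.\<close>

lemma scales_of_combination:
  assumes U: "unitary_op 2 U" and P: "gen_pauli P" and e: "U * P = (x \<cdot>\<^sub>m 1\<^sub>m 2 + y \<cdot>\<^sub>m P) * U"
  shows "scales P U"
proof -
  have c: "U \<in> carrier_mat 2 2" "mat_adjoint U \<in> carrier_mat 2 2" "P \<in> carrier_mat 2 2"
    using U P by auto
  have "mat_trace (U * P * mat_adjoint U) = mat_trace (P * mat_adjoint U * U)"
    using c mat_trace_cyclic [of U "P * mat_adjoint U"] by (simp add: assoc_mult_mat [of _ 2 2 _ 2 _ 2])
  also have "\<dots> = 0" using unitary_cancel_right(2) [OF U c(3)] P by simp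
  also have "U * P * mat_adjoint U = x \<cdot>\<^sub>m 1\<^sub>m 2 + y \<cdot>\<^sub>m P"
    unfolding e using c by (intro unitary_cancel_right(1) [OF U]) auto
  also have "mat_trace (x \<cdot>\<^sub>m 1\<^sub>m 2 + y \<cdot>\<^sub>m P) = 2 * x"
  proof -
    obtain p q r s where Pm: "P = mat2 p q r s" using c(3) by (rule mat2_cases)
    have "x + y * p + (x + y * s) = 2 * x + y * (p + s)" by (simp add: algebra_simps)
    then show ?thesis using gen_pauli_trace [OF P] by (simp add: Pm one_mat2)
  qed
  finally have "x = 0" by simp
  then have "U * P = y \<cdot>\<^sub>m (P * U)"
    using e c by (simp add: mult_smult_assoc_mat [of _ 2 2 _ 2] add_mult_distrib_mat [of _ 2 2 _ _ 2]
        left_mult_one_mat [of _ 2 2])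
      (elim mat2_cases, simp)
  then show ?thesis using c by (auto simp: scales_def)
qed

lemma scales_uminus:
  assumes P: "P \<in> carrier_mat 2 2" and "scales (- P) U"
  shows "scales P U"
proof -
  obtain \<beta> where U: "U \<in> carrier_mat 2 2" and e: "U * - P = \<beta> \<cdot>\<^sub>m (- P * U)"
    using assms by (auto simp: scales_def)
  have "U * P = - (U * - P)" using P U by simp
  also have "\<dots> = - (\<beta> \<cdot>\<^sub>m - (P * U))" unfolding e using P U by simp
  also have "\<dots> = \<beta> \<cdot>\<^sub>m (P * U)" by (rule eq_matI) auto
  finally show ?thesis using U by (auto simp: scales_def)
qed

text \<open>The span of 1 and \<open>P\<close> is closed under multiplication, because
  \<open>P * P = 1\<close>.\<close>

lemma gen_pauli_mult_combination:
  assumes P: "gen_pauli P" and P1: "P1 = P \<or> P1 = - P \<or> P1 = 1\<^sub>m 2 \<or> P1 = - 1\<^sub>m 2"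
  shows "\<exists>u v. P1 * (x \<cdot>\<^sub>m 1\<^sub>m 2 + y \<cdot>\<^sub>m P) = u \<cdot>\<^sub>m 1\<^sub>m 2 + v \<cdot>\<^sub>m P"
proof -
  let ?M = "x \<cdot>\<^sub>m 1\<^sub>m 2 + y \<cdot>\<^sub>m P"
  have P2: "P * ?M = y \<cdot>\<^sub>m 1\<^sub>m 2 + x \<cdot>\<^sub>m P"
    using P by (simp add: mult_add_distrib_mat [of _ 2 2 _ 2] mult_smult_distrib [of _ 2 2 _ 2]
        right_mult_one_mat [of _ 2 2] comm_add_mat [of _ 2 2])
  have neg: "- (u \<cdot>\<^sub>m 1\<^sub>m 2 + v \<cdot>\<^sub>m P) = (- u) \<cdot>\<^sub>m 1\<^sub>m 2 + (- v) \<cdot>\<^sub>m P" for u v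
    using P by (intro eq_matI) (auto simp: carrier_matD [OF gen_pauli_carrier [OF P]])
  have M: "1\<^sub>m 2 * ?M = ?M" using P by (intro left_mult_one_mat [of _ 2 2]) auto
  from P1 show ?thesis
  proof (elim disjE)
    assume "P1 = - P"
    then have "P1 * ?M = - (P * ?M)" using P by simp
    then show ?thesis unfolding P2 neg by blast
  next
    assume "P1 = - 1\<^sub>m 2"
    then have "P1 * ?M = - (1\<^sub>m 2 * ?M)" using P uminus_mult_2(1) [of "1\<^sub>m 2" ?M] by simp
    then show ?thesis unfolding M neg by blast
  qed (use P2 M in blast)+
qed

text \<open>Conjugation by \<open>U\<close> puts both matrices into the commutative algebra spanned
  by 1 and \<open>P\<close>.\<close>

lemma commute_of_combinations:
  assumes U: "unitary_op 2 U" and P: "P \<in> carrier_mat 2 2" "Q1 \<in> carrier_mat 2 2" "Q2 \<in> carrier_mat 2 2"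
    and 1: "U * Q1 = (x1 \<cdot>\<^sub>m 1\<^sub>m 2 + y1 \<cdot>\<^sub>m P) * U" and 2: "U * Q2 = (x2 \<cdot>\<^sub>m 1\<^sub>m 2 + y2 \<cdot>\<^sub>m P) * U"
  shows "Q1 * Q2 = Q2 * Q1"
proof -
  let ?R1 = "x1 \<cdot>\<^sub>m 1\<^sub>m 2 + y1 \<cdot>\<^sub>m P" and ?R2 = "x2 \<cdot>\<^sub>m 1\<^sub>m 2 + y2 \<cdot>\<^sub>m P"
  have c [simp]: "U \<in> carrier_mat 2 2" "?R1 \<in> carrier_mat 2 2" "?R2 \<in> carrier_mat 2 2"
    using U P by auto
  have R: "?R1 * ?R2 = ?R2 * ?R1"
    using P(1) by (elim mat2_cases) (simp add: one_mat2 algebra_simps)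
  have m: "U * (X * Y) = R * S * U" if "U * X = R * U" "U * Y = S * U" "X \<in> carrier_mat 2 2"
    "Y \<in> carrier_mat 2 2" "R \<in> carrier_mat 2 2" "S \<in> carrier_mat 2 2" for X Y R S
  proof -
    have "U * (X * Y) = R * U * Y" using that by (simp flip: assoc_mult_mat [of _ 2 2 _ 2 _ 2])
    also have "\<dots> = R * S * U" using that by (simp add: assoc_mult_mat [of _ 2 2 _ 2 _ 2])
    finally show ?thesis .
  qed
  have "U * (Q1 * Q2) = U * (Q2 * Q1)"
    using m [OF 1 2] m [OF 2 1] R P by simp
  then have "mat_adjoint U * (U * (Q1 * Q2)) = mat_adjoint U * (U * (Q2 * Q1))" by simp
  then show ?thesis using unitary_cancel_left(1) [OF U, of _ 2] P by simp
qed

section \<open>Images of corrections under the interaction, and the case analysis\<close>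

lemma tensor_commutes_to_transports:
  assumes E: "unitary_op 4 E" and P: "P \<in> carrier_mat 2 2" and t: "tensor_commutes_to E P P'"
  obtains A where "gen_pauli_or_pm_id A" "gen_pauli_or_pm_id P'" "transports E P (A \<otimes>\<^sub>k P')"
proof -
  obtain A where A: "gen_pauli_or_pm_id A" "gen_pauli_or_pm_id P'"
    and e: "E * (1\<^sub>m 2 \<otimes>\<^sub>k P) * mat_adjoint E = A \<otimes>\<^sub>k P'"
    using t by (auto simp: tensor_commutes_to_def)
  have "E * (1\<^sub>m 2 \<otimes>\<^sub>k P) * mat_adjoint E * E = E * (1\<^sub>m 2 \<otimes>\<^sub>k P)"
    using E P by (intro unitary_cancel_right(2)) auto
  moreover have "A \<in> carrier_mat 2 2" "P' \<in> carrier_mat 2 2"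
    using A by (auto simp: gen_pauli_or_pm_id_def)
  ultimately have "transports E P (A \<otimes>\<^sub>k P')" using P e by (simp add: transports_def)
  with that A show ?thesis by blast
qed

text \<open>A sign on a trivial factor moves to the other factor. Both factors cannot be trivial: by
  injectivity \<open>P\<close> would then be the identity up to sign, whose trace is
  nonzero.\<close>

lemma transports_gen_pauli_cases:
  assumes E: "unitary_op 4 E" and P: "gen_pauli P"
    and A: "gen_pauli_or_pm_id A" and B: "gen_pauli_or_pm_id B" and t: "transports E P (A \<otimes>\<^sub>k B)"
  obtains (register) B' where "gen_pauli B'" "transports E P (1\<^sub>m 2 \<otimes>\<^sub>k B')"
  | (ancilla) A' where "gen_pauli A'" "transports E P (A' \<otimes>\<^sub>k 1\<^sub>m 2)"
  | (both) "gen_pauli A" "gen_pauli B"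
proof -
  have one: "transports E (1\<^sub>m 2) (1\<^sub>m 2 \<otimes>\<^sub>k 1\<^sub>m 2)" "transports E (- 1\<^sub>m 2) (- (1\<^sub>m 2 \<otimes>\<^sub>k 1\<^sub>m 2))"
    using transports_one transports_uminus E by (simp_all add: kron_one_one)
  have trivial: False if "transports E P (1\<^sub>m 2 \<otimes>\<^sub>k 1\<^sub>m 2) \<or> transports E P (- (1\<^sub>m 2 \<otimes>\<^sub>k 1\<^sub>m 2))"
  proof -
    have "P = 1\<^sub>m 2 \<or> P = - 1\<^sub>m 2" using that one transports_inj [OF E] by blast
    then show False using gen_pauli_trace [OF P] by (auto simp: one_mat2)
  qed
  show ?thesis
    using A B t trivial register [of B] register [of "- B"] ancilla [of A] ancilla [of "- A"] both
    by (auto simp: gen_pauli_or_pm_id_def kron_uminus_left kron_uminus_right)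
qed

theorem mainTheorem1:
  fixes E :: "complex mat" and S :: scheme
  assumes "unitary_op 4 E"
    and "valid_scheme S"
    and "stepwise_deterministic E S"
    and "tensor_commuting E S"
    and "universal E S"
  shows "\<exists>W' W V' V D \<phi>.
    unitary_op 2 W' \<and> unitary_op 2 W \<and> unitary_op 2 V' \<and> unitary_op 2 V \<and>
    (D = nonlocal_D (pi / 4) 0 0 \<or> D = nonlocal_D (pi / 4) (pi / 4) 0) \<and>
    E = cis \<phi> \<cdot>\<^sub>m ((W' \<otimes>\<^sub>k W) * D * (V' \<otimes>\<^sub>k V))"
proof -
  note E = assms(1)
  have cE [simp]: "E \<in> carrier_mat 4 4" using E by simp
  obtain \<P> where gp: "\<And>P. P \<in> \<P> \<Longrightarrow> gen_pauli P" and sub: "correction_factors E S \<subseteq> \<P>"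
    and tc: "\<And>P. P \<in> \<P> \<Longrightarrow> \<exists>P'. tensor_commutes_to E P P' \<and> (P' \<in> \<P> \<or> P' = 1\<^sub>m 2 \<or> P' = - 1\<^sub>m 2)"
    using assms(4) unfolding tensor_commuting_def by blast
  have "\<exists>P\<in>\<P>. \<exists>Q\<in>\<P>. Q \<noteq> P \<and> Q \<noteq> - P"
  proof (rule ccontr)
    assume "\<not> ?thesis"
    \<comment> \<open>If \<open>\<P>\<close> is empty, any generalized Pauli serves as
      \<open>P0\<close>.\<close>
    then obtain P0 where P0: "gen_pauli P0" and only: "\<And>Q. Q \<in> \<P> \<Longrightarrow> Q = P0 \<or> Q = - P0"
      using gp gen_pauli_XYZ by (metis (no_types, lifting))
    have "\<not> universal E S"
    proof (rule not_universal_if_scaling [OF P0])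
      fix t V assume t: "t \<in> single_settings S" and V: "induces_unitary 1 E (Single t 0) Plus V"
      obtain U P where U: "unitary_op 2 U" and P: "gen_pauli P" "P \<in> correction_factors E S"
        and VU: "\<And>V. induces_unitary 1 E (Single t 0) Plus V \<Longrightarrow> \<exists>k. V = k \<cdot>\<^sub>m U"
        and act: "\<And>Q A B. A \<in> carrier_mat 2 2 \<Longrightarrow> B \<in> carrier_mat 2 2 \<Longrightarrow> transports E Q (A \<otimes>\<^sub>k B) \<Longrightarrow>
          \<exists>x y. U * Q = B * ((x \<cdot>\<^sub>m 1\<^sub>m 2 + y \<cdot>\<^sub>m P) * U)"
        by (rule single_step_action [OF E assms(2,3) t]) (rule that; assumption)
      have P': "P \<in> \<P>" using P sub by blast
      obtain P1 where P1: "tensor_commutes_to E P P1" "P1 \<in> \<P> \<or> P1 = 1\<^sub>m 2 \<or> P1 = - 1\<^sub>m 2"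
        using tc [OF P'] by blast
      obtain A where A: "gen_pauli_or_pm_id A" "transports E P (A \<otimes>\<^sub>k P1)"
        using tensor_commutes_to_transports [OF E _ P1(1)] P by auto
      have c: "A \<in> carrier_mat 2 2" "P1 \<in> carrier_mat 2 2"
        using A(1) P1(2) gp by (auto simp: gen_pauli_or_pm_id_def)
      obtain x y where xy: "U * P = P1 * ((x \<cdot>\<^sub>m 1\<^sub>m 2 + y \<cdot>\<^sub>m P) * U)"
        using act [OF c A(2)] by blast
      \<comment> \<open>\<open>P1\<close> belongs to \<open>\<P>\<close> or is the identity up to
        sign, and \<open>\<P>\<close> offers only \<open>P\<close> up to sign. So multiplying by
        \<open>P1\<close> stays in the span of 1 and \<open>P\<close>.\<close>
      have "P1 = P \<or> P1 = - P \<or> P1 = 1\<^sub>m 2 \<or> P1 = - 1\<^sub>m 2"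
        using P1(2) only [of P1] only [OF P'] by auto
      then obtain u v where "P1 * (x \<cdot>\<^sub>m 1\<^sub>m 2 + y \<cdot>\<^sub>m P) = u \<cdot>\<^sub>m 1\<^sub>m 2 + v \<cdot>\<^sub>m P"
        using gen_pauli_mult_combination [OF P(1)] by blast
      then have "U * P = (u \<cdot>\<^sub>m 1\<^sub>m 2 + v \<cdot>\<^sub>m P) * U"
        using xy c U P by (simp flip: assoc_mult_mat [of _ 2 2 _ 2 _ 2])
      then have "scales P U" using scales_of_combination U P by blast
      then have "scales P0 U"
        using only [OF P'] scales_uminus P0 by auto
      then show "scales P0 V" using VU [OF V] scales_smult P0 by auto
    qed
    with assms(5) show False by blast
  qed
  then obtain P Q where PQ: "P \<in> \<P>" "Q \<in> \<P>" "Q \<noteq> P" "Q \<noteq> - P" by blast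
  have gP: "gen_pauli P" "gen_pauli Q" using PQ gp by auto
  have ncomm: "P * Q \<noteq> Q * P" using gen_pauli_commute gP PQ by blast
  \<comment> \<open>Without any single-qubit step the scaling condition for \<open>pauli_X\<close>
    would hold vacuously and contradict universality.\<close>
  obtain t where t: "t \<in> single_settings S"
    using not_universal_if_scaling [OF gen_pauli_XYZ(1)] assms(5) by blast
  obtain U R where U: "unitary_op 2 U" and R: "gen_pauli R"
    and act: "\<And>Q A B. A \<in> carrier_mat 2 2 \<Longrightarrow> B \<in> carrier_mat 2 2 \<Longrightarrow> transports E Q (A \<otimes>\<^sub>k B) \<Longrightarrow>
      \<exists>x y. U * Q = B * ((x \<cdot>\<^sub>m 1\<^sub>m 2 + y \<cdot>\<^sub>m R) * U)"
    and act1: "\<And>Q B. B \<in> carrier_mat 2 2 \<Longrightarrow> transports E Q (1\<^sub>m 2 \<otimes>\<^sub>k B) \<Longrightarrow>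
      U * Q = B * U \<and> R * U * Q = B * (R * U)"
    by (rule single_step_action [OF E assms(2,3) t]) (rule that; assumption)
  obtain P' A where A: "gen_pauli_or_pm_id A" "gen_pauli_or_pm_id P'" "transports E P (A \<otimes>\<^sub>k P')"
    using tc [OF PQ(1)] tensor_commutes_to_transports [OF E gen_pauli_carrier [OF gP(1)]] by blast
  obtain Q' B where B: "gen_pauli_or_pm_id B" "gen_pauli_or_pm_id Q'" "transports E Q (B \<otimes>\<^sub>k Q')"
    using tc [OF PQ(2)] tensor_commutes_to_transports [OF E gen_pauli_carrier [OF gP(2)]] by blast
  \<comment> \<open>Both \<open>U\<close> and \<open>R * U\<close> intertwine \<open>X\<close> with
    \<open>C\<close>, so \<open>R\<close> commutes with \<open>C\<close>.\<close>
  have RB: "R * C = C * R" if "gen_pauli C" "transports E X (1\<^sub>m 2 \<otimes>\<^sub>k C)" for C X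
  proof -
    have X: "X \<in> carrier_mat 2 2" using that by (simp add: transports_def)
    have "U * X = C * U" "R * U * X = C * (R * U)" using act1 that by auto
    then have "R * C * U = C * R * U"
      using U R X that(1) by (simp add: assoc_mult_mat [of _ 2 2 _ 2 _ 2])
    then have "R * C * U * mat_adjoint U = C * R * U * mat_adjoint U" by simp
    then show ?thesis using unitary_cancel_right(1) [OF U, of _ 2] R that(1) by simp
  qed
  \<comment> \<open>The images act on different sides and commute; injectivity carries this back to
    \<open>X\<close> and \<open>Y\<close>.\<close>
  have mixed: "X * Y = Y * X"
    if "transports E X (1\<^sub>m 2 \<otimes>\<^sub>k C)" "transports E Y (F \<otimes>\<^sub>k 1\<^sub>m 2)" "gen_pauli C" "gen_pauli F" for X Y C F
  proof -
    have "transports E (X * Y) (F \<otimes>\<^sub>k C)" "transports E (Y * X) (F \<otimes>\<^sub>k C)"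
      using transports_mult [OF cE that(1,2)] transports_mult [OF cE that(2,1)] that(3,4)
      by (simp_all add: kron_mult [of _ 2 2 _ 2 2 _ 2 _ 2] left_mult_one_mat [of _ 2 2] right_mult_one_mat [of _ 2 2])
    then show ?thesis by (rule transports_inj [OF E])
  qed
  have "maximally_coupled E"
    using E gP(1) A
  proof (cases rule: transports_gen_pauli_cases)
    case (register B1)
    note P1 = this
    show ?thesis using E gP(2) B
    proof (cases rule: transports_gen_pauli_cases)
      case (register B2)
      \<comment> \<open>Both register images commute with the correction \<open>R\<close> of one
        fixed step, so they agree up to sign, and then so do \<open>P\<close> and
        \<open>Q\<close>.\<close>
      have B1: "B1 = R \<or> B1 = - R" and B2: "B2 = R \<or> B2 = - R"
        using gen_pauli_commute [OF R P1(1) RB [OF P1]] gen_pauli_commute [OF R register(1) RB [OF register]] .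
      have "B2 = B1 \<or> B2 = - B1" using B1 B2 by auto
      then have "Q = P \<or> Q = - P"
        using transports_inj [OF E register(2)] P1(2) transports_uminus [OF cE P1(2)]
        by (auto simp: kron_uminus_right)
      with PQ show ?thesis by blast
    next
      case (ancilla A2)
      then show ?thesis using mixed [OF P1(2) ancilla(2) P1(1) ancilla(1)] ncomm by simp
    next
      case both
      then show ?thesis
        using ising_from_transports [OF E gP both(1) P1(1) both(2) P1(2) B(3)]
        unfolding maximally_coupled_def by blast
    qed
  next
    case (ancilla A1)
    note P1 = this
    show ?thesis using E gP(2) B
    proof (cases rule: transports_gen_pauli_cases)
      case (register B2)
      then show ?thesis using mixed [OF register(2) P1(2) register(1) P1(1)] ncomm by simp
    next
      case (ancilla A2)
      \<comment> \<open>With trivial register factors, \<open>U\<close> conjugates both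
        \<open>P\<close> and \<open>Q\<close> into the span of 1 and \<open>R\<close>, which is
        commutative.\<close>
      have one: "1\<^sub>m 2 * ((x \<cdot>\<^sub>m 1\<^sub>m 2 + y \<cdot>\<^sub>m R) * U) = (x \<cdot>\<^sub>m 1\<^sub>m 2 + y \<cdot>\<^sub>m R) * U" for x y
        using R U by (intro left_mult_one_mat [of _ 2 2]) auto
      obtain x1 y1 where 1: "U * P = (x1 \<cdot>\<^sub>m 1\<^sub>m 2 + y1 \<cdot>\<^sub>m R) * U"
        using act [OF gen_pauli_carrier [OF P1(1)] one_carrier_mat P1(2)] one by auto
      obtain x2 y2 where 2: "U * Q = (x2 \<cdot>\<^sub>m 1\<^sub>m 2 + y2 \<cdot>\<^sub>m R) * U"
        using act [OF gen_pauli_carrier [OF ancilla(1)] one_carrier_mat ancilla(2)] one by auto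
      have "P * Q = Q * P"
        by (rule commute_of_combinations [OF U _ _ _ 1 2]) (use R gP in auto)
      with ncomm show ?thesis by simp
    next
      case both
      then show ?thesis
        using xx_from_transports [OF E gP P1(1) both P1(2) B(3)]
        unfolding maximally_coupled_def by blast
    qed
  next
    case both
    note P1 = this
    show ?thesis using E gP(2) B
    proof (cases rule: transports_gen_pauli_cases)
      case (register B2)
      \<comment> \<open>Here \<open>Q\<close> has the one-sided image, so the roles of
        \<open>P\<close> and \<open>Q\<close> are exchanged.\<close>
      then show ?thesis
        using ising_from_transports [OF E gP(2,1) P1(1) register(1) P1(2) register(2) A(3)]
        unfolding maximally_coupled_def by blast
    next
      case (ancilla A2)
      then show ?thesis
        using xx_from_transports [OF E gP(2,1) ancilla(1) P1 ancilla(2) A(3)]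
        unfolding maximally_coupled_def by blast
    next
      case both
      then show ?thesis
        using maximally_coupled_of_both [OF E gP PQ(3,4) P1(1) both(1) P1(2) both(2) A(3) B(3)] by blast
    qed
  qed
  then show ?thesis
    unfolding maximally_coupled_def
  proof (elim exE conjE)
    fix W' W V' V D
    assume *: "unitary_op 2 W'" "unitary_op 2 W" "unitary_op 2 V'" "unitary_op 2 V"
      "D = nonlocal_D (pi / 4) 0 0 \<or> D = nonlocal_D (pi / 4) (pi / 4) 0"
      "E = (W' \<otimes>\<^sub>k W) * D * (V' \<otimes>\<^sub>k V)"
    have "E = cis 0 \<cdot>\<^sub>m ((W' \<otimes>\<^sub>k W) * D * (V' \<otimes>\<^sub>k V))"
      unfolding *(6) [symmetric] by (rule eq_matI) auto
    with * show ?thesis by blast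
  qed
qed

end
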